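(* Let $k$ be a field and let $A$ be a normal $k$-algebra which is an integral domain, of finite expansion over $k$, and of Krull dimension $1$. Then $A$ is a Prüfer domain; that is, for every maximal ideal $\mathfrak{m} \subset A$, the localization $A_\mathfrak{m}$ is a valuation ring.
   Context: A $k$-algebra $A$ is of finite expansion over $k$ if there are finitely many $a_1,\dots,a_n \in A$ with $A$ integral over $k[a_1,\dots,a_n]$. Normal means integrally closed in the field of fractions. *)

theory Defs
  imports "HOL-Computational_Algebra.Polynomial" "HOL-Computational_Algebra.Fraction_Field"
    "HOL-Library.Extended_Nat"
begin

(* The field k is modelled as a subfield K of the domain A (= the type 'a);
   for a nonzero domain the structure map k -> A is injective. *)

definition is_subring :: "'a::comm_ring_1 set \<Rightarrow> bool" where
  "is_subring R \<longleftrightarrow> 0 \<in> R \<and> 1 \<in> R \<and>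
     (\<forall>x\<in>R. \<forall>y\<in>R. x + y \<in> R \<and> x * y \<in> R \<and> - x \<in> R)"

definition is_subfield :: "'a::comm_ring_1 set \<Rightarrow> bool" where
  "is_subfield K \<longleftrightarrow> is_subring K \<and> (\<forall>x\<in>K. x \<noteq> 0 \<longrightarrow> (\<exists>y\<in>K. x * y = 1))"

definition ring_adjoin :: "'a::comm_ring_1 set \<Rightarrow> 'a set" where
  "ring_adjoin S = \<Inter>{R. is_subring R \<and> S \<subseteq> R}"

definition integral_over :: "'a::comm_ring_1 set \<Rightarrow> 'a \<Rightarrow> bool" where
  "integral_over R x \<longleftrightarrow>
     (\<exists>p. lead_coeff p = 1 \<and> (\<forall>i. coeff p i \<in> R) \<and> poly p x = 0)"

definition finite_expansion :: "'a::comm_ring_1 set \<Rightarrow> bool" where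
  "finite_expansion K \<longleftrightarrow>
     (\<exists>S. finite S \<and> (\<forall>a. integral_over (ring_adjoin (K \<union> S)) a))"

definition normal_domain :: "'a::idom itself \<Rightarrow> bool" where
  "normal_domain _ \<longleftrightarrow>
     (\<forall>z::'a fract. integral_over (range (\<lambda>a. Fract a 1)) z \<longrightarrow> z \<in> range (\<lambda>a. Fract a 1))"

definition is_ideal :: "'a::comm_ring_1 set \<Rightarrow> bool" where
  "is_ideal I \<longleftrightarrow> 0 \<in> I \<and> (\<forall>x\<in>I. \<forall>y\<in>I. x + y \<in> I) \<and> (\<forall>x\<in>I. \<forall>r. r * x \<in> I)"

definition is_prime_ideal :: "'a::comm_ring_1 set \<Rightarrow> bool" where
  "is_prime_ideal P \<longleftrightarrow> is_ideal P \<and> P \<noteq> UNIV \<and> (\<forall>x y. x * y \<in> P \<longrightarrow> x \<in> P \<or> y \<in> P)"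

definition is_maximal_ideal :: "'a::comm_ring_1 set \<Rightarrow> bool" where
  "is_maximal_ideal M \<longleftrightarrow> is_ideal M \<and> M \<noteq> UNIV \<and>
     (\<forall>J. is_ideal J \<and> M \<subseteq> J \<longrightarrow> J = M \<or> J = UNIV)"

definition krull_dim :: "'a::comm_ring_1 itself \<Rightarrow> enat" where
  "krull_dim _ = Sup {enat n | n. \<exists>P :: nat \<Rightarrow> 'a set.
      (\<forall>i\<le>n. is_prime_ideal (P i)) \<and> (\<forall>i<n. P i \<subset> P (Suc i))}"

definition localization_at :: "'a::idom set \<Rightarrow> 'a fract set" where
  "localization_at P = {Fract a s | a s. s \<notin> P}"

definition frac_field_of :: "'b::field set \<Rightarrow> 'b set" where
  "frac_field_of V = {a / b | a b. a \<in> V \<and> b \<in> V \<and> b \<noteq> 0}"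

definition valuation_ring :: "'b::field set \<Rightarrow> bool" where
  "valuation_ring V \<longleftrightarrow> is_subring V \<and>
     (\<forall>x \<in> frac_field_of V. x \<noteq> 0 \<longrightarrow> x \<in> V \<or> inverse x \<in> V)"

definition prufer_domain :: "'a::idom itself \<Rightarrow> bool" where
  "prufer_domain _ \<longleftrightarrow>
     (\<forall>M::'a set. is_maximal_ideal M \<longrightarrow> valuation_ring (localization_at M))"

end

theory Submission
  imports Defs "Jordan_Normal_Form.Char_Poly"
begin

text \<open>The dimension hypothesis enters only through the fact that any two elements of $A$ are
  algebraically dependent over $K$. If $u, v$ were independent, let $P$ be an ideal maximal among
  those disjoint from $K[u] - \{0\}$. Zariski's lemma over $K(u)$ makes $v$ algebraic over $K[u]$
  modulo $P$, so $P \neq 0$; Zariski's lemma over $K$ shows that $P$ is not maximal, since $u$ is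
  transcendental modulo $P$. Thus there is a chain of primes $0 \subset P \subset M$ in $A$.

  Let $x = a/b$ be a fraction. If $b$ is algebraic over $K$, it is a unit. Otherwise there is an
  equation $\sum c_i x^i = 0$ with $c_i \in K[b]$ not all zero. As $K[b]$ is principal, one
  can cancel until some $c_i$ lies outside the given maximal ideal $M$, and then integral closedness puts $x$ or $x^{-1}$ into $A_M$.\<close>

subsection \<open>Integral elements over a subring\<close>

text \<open>Finite expansion allows any integral extension on top of a finitely generated algebra,
  so A need not be Noetherian. Zariski's lemma is therefore stated for rings integral over R[S], a
  condition that survives moving one generator from S into R. Residue rings and localizations of A
  are not formed in its proof. An element of A/P is a congruence modulo P, and a denominator is a
  multiplier outside P; hence conclusions such as "c * x is integral over R for some c in R - P".
  Avoiding K[u] - {0} serves two opposite ends. Since P meets K[u] only in 0, u stays transcendental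
  modulo P. By maximality, each element outside P has a multiple congruent to a nonzero element of
  K[u], so that A/P becomes a field once K[u] - {0} is inverted, as Zariski's lemma over K(u)
  requires. In the second half, a relation for x whose coefficients all lie in M says nothing about
  x modulo M. Cancellation in the principal ring K[b] repairs this; it needs b transcendental, so
  that K[b] is a polynomial ring with a degree to descend on.\<close>

lemma
  assumes "is_subring R"
  shows subring_0: "0 \<in> R"
    and subring_1: "1 \<in> R"
    and subring_add: "\<And>x y. x \<in> R \<Longrightarrow> y \<in> R \<Longrightarrow> x + y \<in> R"
    and subring_mult: "\<And>x y. x \<in> R \<Longrightarrow> y \<in> R \<Longrightarrow> x * y \<in> R"
    and subring_uminus: "\<And>x. x \<in> R \<Longrightarrow> - x \<in> R"
  using assms unfolding is_subring_def by auto

lemma subring_diff: "is_subring R \<Longrightarrow> x \<in> R \<Longrightarrow> y \<in> R \<Longrightarrow> x - y \<in> R"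
  using subring_add[of R x "- y"] subring_uminus[of R y] by simp

lemma subring_power: "is_subring R \<Longrightarrow> x \<in> R \<Longrightarrow> x ^ n \<in> R"
  by (induct n) (auto intro: subring_1 subring_mult)

lemma subring_sum: "is_subring R \<Longrightarrow> (\<And>i. i \<in> I \<Longrightarrow> f i \<in> R) \<Longrightarrow> sum f I \<in> R"
  by (induct I rule: infinite_finite_induct) (auto intro: subring_0 subring_add)

lemma subring_prod: "is_subring R \<Longrightarrow> (\<And>i. i \<in> I \<Longrightarrow> f i \<in> R) \<Longrightarrow> prod f I \<in> R"
  by (induct I rule: infinite_finite_induct) (auto intro: subring_1 subring_mult)

lemmas subring_closed = subring_0 subring_1 subring_add subring_mult subring_uminus
  subring_diff subring_power subring_sum subring_prod

definition polys_over :: "'a::zero set \<Rightarrow> 'a poly set" where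
  "polys_over R = {p. \<forall>i. coeff p i \<in> R}"

lemma polys_overD: "p \<in> polys_over R \<Longrightarrow> coeff p i \<in> R"
  by (simp add: polys_over_def)

lemma polys_overI: "(\<And>i. coeff p i \<in> R) \<Longrightarrow> p \<in> polys_over R"
  by (simp add: polys_over_def)

lemma subring_polys_over: "is_subring R \<Longrightarrow> is_subring (polys_over R)"
  by (subst is_subring_def)
    (auto simp: polys_over_def coeff_mult pCons_one[symmetric] coeff_pCons
      intro!: subring_closed split: nat.split)

lemma poly_in_subring:
  "is_subring R \<Longrightarrow> p \<in> polys_over R \<Longrightarrow> x \<in> R \<Longrightarrow> poly p x \<in> R"
  by (auto simp: poly_altdef intro!: subring_closed dest: polys_overD)

lemma polys_over_pCons: "pCons a p \<in> polys_over R \<longleftrightarrow> a \<in> R \<and> p \<in> polys_over R"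
  unfolding polys_over_def by (auto simp: coeff_pCons split: nat.splits)

lemma polys_over_monom: "is_subring R \<Longrightarrow> a \<in> R \<Longrightarrow> monom a n \<in> polys_over R"
  by (auto intro!: polys_overI simp: subring_0)

lemma polys_over_mono: "R \<subseteq> R' \<Longrightarrow> p \<in> polys_over R \<Longrightarrow> p \<in> polys_over R'"
  by (auto simp: polys_over_def)

text \<open>The R-submodule generated by M, built one summand at a time so that closure properties
  follow by induction. For finite M, \<open>span_over_finite\<close> recovers a coefficient
  function.\<close>

inductive_set span_over :: "'a::comm_ring_1 set \<Rightarrow> 'a set \<Rightarrow> 'a set" for R M where
  zero: "0 \<in> span_over R M"
| step: "r \<in> R \<Longrightarrow> m \<in> M \<Longrightarrow> x \<in> span_over R M \<Longrightarrow> r * m + x \<in> span_over R M"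

lemma span_over_base: "r \<in> R \<Longrightarrow> m \<in> M \<Longrightarrow> r * m \<in> span_over R M"
  using span_over.step[OF _ _ span_over.zero] by force

lemma span_over_add: "x \<in> span_over R M \<Longrightarrow> y \<in> span_over R M \<Longrightarrow> x + y \<in> span_over R M"
  by (induct rule: span_over.induct) (auto intro: span_over.intros simp: add.assoc)

lemma span_over_sum: "(\<And>i. i \<in> I \<Longrightarrow> f i \<in> span_over R M) \<Longrightarrow> sum f I \<in> span_over R M"
  by (induct I rule: infinite_finite_induct) (auto intro: span_over.zero span_over_add)

lemma span_over_scale:
  assumes "is_subring R" "r \<in> R" "x \<in> span_over R M"
  shows "r * x \<in> span_over R M"
  using assms(3)
proof induct
  case (step s m x)
  have "r * (s * m + x) = (r * s) * m + r * x" by (simp add: algebra_simps)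
  with step assms show ?case by (auto intro: span_over.step subring_mult)
qed (auto intro: span_over.zero)

lemma span_over_mult:
  assumes R: "is_subring R" and x: "x \<in> span_over R M" and y: "y \<in> span_over R N"
  shows "x * y \<in> span_over R {m * n |m n. m \<in> M \<and> n \<in> N}"
  using x
proof induct
  case (step r m x)
  have "m * y \<in> span_over R {m * n |m n. m \<in> M \<and> n \<in> N}"
    using y
  proof induct
    case (step s n y)
    have "m * (s * n + y) = s * (m * n) + m * y" by (simp add: algebra_simps)
    with step \<open>m \<in> M\<close> show ?case by (auto intro!: span_over.step)
  qed (auto intro: span_over.zero)
  from span_over_scale[OF R step(1) this] step(4)
  have "r * (m * y) + x * y \<in> span_over R {m * n |m n. m \<in> M \<and> n \<in> N}"
    by (rule span_over_add)
  then show ?case by (simp add: algebra_simps)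
qed (auto intro: span_over.zero)

lemma span_over_finite:
  assumes "is_subring R" "finite M" "x \<in> span_over R M"
  shows "\<exists>c. (\<forall>m. c m \<in> R) \<and> x = (\<Sum>m\<in>M. c m * m)"
  using assms(3)
proof induct
  case zero
  show ?case by (rule exI[of _ "\<lambda>_. 0"]) (simp add: subring_0[OF assms(1)])
next
  case (step r m x)
  then obtain c where c: "\<forall>m. c m \<in> R" "x = (\<Sum>m\<in>M. c m * m)" by auto
  have "r * m + x = (\<Sum>n\<in>M. (c n + (if n = m then r else 0)) * n)"
    using step(2) assms(2) c(2)
    by (simp add: distrib_right sum.distrib if_distrib[of "\<lambda>u. u * _"] cong: if_cong)
  then show ?case
    using c step assms(1)
    by (intro exI[of _ "\<lambda>n. c n + (if n = m then r else 0)"]) (auto intro: subring_closed)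
qed

section \<open>Integrality through stable spans\<close>

lemma integral_over_alt: "integral_over R x \<longleftrightarrow> (\<exists>p\<in>polys_over R. lead_coeff p = 1 \<and> poly p x = 0)"
  unfolding integral_over_def polys_over_def by auto

lemma integral_over_mono: "R \<subseteq> R' \<Longrightarrow> integral_over R x \<Longrightarrow> integral_over R' x"
  unfolding integral_over_def by blast

lemma monic_power_eq:
  fixes p :: "'a::comm_ring_1 poly"
  assumes "lead_coeff p = 1"
  shows "poly p x = x ^ degree p + (\<Sum>i<degree p. coeff p i * x ^ i)"
  using assms by (simp add: poly_altdef lessThan_Suc_atMost[symmetric])

text \<open>The products m * x^i are stable under x, since the monic equation rewrites the top
  power. The coefficients need not lie in R, only map M into its span: \<open>M = {1}\<close> gives
  the criterion for one integral element, larger M give transitivity.\<close>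

lemma stable_span_of_monic:
  assumes R: "is_subring R" and M: "finite M" "1 \<in> M"
    and p: "lead_coeff p = 1" "poly p x = 0"
    and c: "\<And>i m. m \<in> M \<Longrightarrow> coeff p i * m \<in> span_over R M"
  shows "\<exists>M'. finite M' \<and> 1 \<in> M' \<and> (\<forall>m\<in>M'. x * m \<in> span_over R M')"
proof -
  let ?n = "degree p"
  \<comment> \<open>The exponent \<open>?n\<close> is included, so that 1 belongs to X without a
    case split on the degree; the equation is accordingly needed for x^(n+1), one above its
    degree.\<close>
  define X where "X = {x ^ i |i. i \<le> ?n}"
  define M' where "M' = {m * y |m y. m \<in> M \<and> y \<in> X}"
  have sX: "x ^ i \<in> span_over R X" if "i \<le> ?n" for i
    using span_over_base[of 1 R "x ^ i" X] that subring_1[OF R] by (auto simp: X_def)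
  have top: "x ^ Suc ?n = (\<Sum>i<?n. (- coeff p i) * x ^ Suc i)"
  proof -
    have "x ^ ?n = - (\<Sum>i<?n. coeff p i * x ^ i)"
      using p(2) monic_power_eq[OF p(1), of x] by (simp add: eq_neg_iff_add_eq_0)
    then show ?thesis
      by (simp add: sum_distrib_left sum_negf algebra_simps)
  qed
  have "x * (m * y) \<in> span_over R M'" if m: "m \<in> M" and y: "y \<in> X" for m y
  proof -
    obtain i where i: "i \<le> ?n" "y = x ^ i" using y by (auto simp: X_def)
    show ?thesis
    proof (cases "i < ?n")
      case True
      have "1 * (m * x ^ Suc i) \<in> span_over R M'"
        using True m by (intro span_over_base subring_1[OF R]) (use True in \<open>force simp: M'_def X_def simp del: power_Suc\<close>)
      then show ?thesis by (simp add: i algebra_simps)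
    next
      case False
      then have "x * (m * y) = m * x ^ Suc ?n" using i by (simp add: algebra_simps)
      also have "\<dots> = (\<Sum>i<?n. (- 1 * (coeff p i * m)) * x ^ Suc i)"
        unfolding top by (simp add: sum_distrib_left algebra_simps)
      also have "\<dots> \<in> span_over R M'"
        unfolding M'_def
        using R by (intro span_over_sum span_over_mult span_over_scale c m sX)
          (auto intro: subring_closed)
      finally show ?thesis .
    qed
  qed
  moreover have "finite M'"
    unfolding M'_def X_def using M(1) by (intro finite_image_set2) auto
  moreover have "1 \<in> X" unfolding X_def by (auto intro: exI[of _ 0])
  then have "1 \<in> M'"
    unfolding M'_def using M(2) by force
  ultimately show ?thesis unfolding M'_def by blast
qed

text \<open>The determinant trick: $x$ is a root of the characteristic polynomial of a matrix of
  multiplication by $x$ on the span of $M$, because that span contains $1$.\<close>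

lemma stable_span_imp_integral_over:
  assumes R: "is_subring R" and M: "finite M" "1 \<in> M"
    and st: "\<And>m. m \<in> M \<Longrightarrow> x * m \<in> span_over R M"
  shows "integral_over R x"
proof -
  define n where "n = card M"
  obtain e where e: "bij_betw e {0..<n} M"
    using ex_bij_betw_nat_finite[OF M(1)] by (auto simp: n_def)
  have "\<exists>c. (\<forall>m. c m \<in> R) \<and> x * k = (\<Sum>m\<in>M. c m * m)" if "k \<in> M" for k
    using span_over_finite[OF R M(1) st[OF that]] .
  then obtain c where c: "\<And>k m. k \<in> M \<Longrightarrow> c k m \<in> R"
    "\<And>k. k \<in> M \<Longrightarrow> x * k = (\<Sum>m\<in>M. c k m * m)" by metis
  have eM: "e i \<in> M" if "i < n" for i using e that by (auto simp: bij_betw_def)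
  define A where "A = mat n n (\<lambda>(i, j). c (e i) (e j))"
  have A: "A \<in> carrier_mat n n" by (simp add: A_def)
  define B where "B = mat n n (\<lambda>(i, j). (if i = j then x else 0) - A $$ (i, j))"
  have B: "B \<in> carrier_mat n n" by (simp add: B_def)
  have pB: "poly (char_poly A) x = det B"
    unfolding char_poly_def
    by (rule poly_det_cong[of _ n]) (use A in \<open>auto simp: B_def char_poly_matrix_def\<close>)
  define v where "v = vec n e"
  have v: "v \<in> carrier_vec n" by (simp add: v_def)
  have "B *\<^sub>v v = 0\<^sub>v n"
  proof (rule eq_vecI)
    fix i assume "i < dim_vec (0\<^sub>v n)"
    then have i: "i < n" by simp
    have "(B *\<^sub>v v) $ i = (\<Sum>j = 0..<n. ((if i = j then x else 0) - c (e i) (e j)) * e j)"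
      using i by (simp add: B_def A_def v_def scalar_prod_def)
    also have "\<dots> = (\<Sum>j = 0..<n. if i = j then x * e j else 0) - (\<Sum>j = 0..<n. c (e i) (e j) * e j)"
      unfolding sum_subtractf[symmetric] by (intro sum.cong) (auto simp: algebra_simps)
    also have "(\<Sum>j = 0..<n. c (e i) (e j) * e j) = (\<Sum>m\<in>M. c (e i) m * m)"
      by (rule sum.reindex_bij_betw[OF e])
    also have "\<dots> = x * e i" using c(2)[OF eM[OF i]] by simp
    finally show "(B *\<^sub>v v) $ i = 0\<^sub>v n $ i" using i by simp
  qed (use B in auto)
  \<comment> \<open>The adjugate turns B v = 0 into det B * e j = 0 for every j; the generator e i =
    1 leaves det B = 0.\<close>
  then have "(adj_mat B * B) *\<^sub>v v = 0\<^sub>v n"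
    using adj_mat(1)[OF B] B v by (simp add: assoc_mult_mat_vec[of _ n n _ n]) auto
  then have z: "(det B \<cdot>\<^sub>m 1\<^sub>m n) *\<^sub>v v = 0\<^sub>v n" using adj_mat(3)[OF B] by simp
  obtain i where i: "i < n" "e i = 1" using M(2) e by (auto simp: bij_betw_def)
  have "((det B \<cdot>\<^sub>m 1\<^sub>m n) *\<^sub>v v) $ i = (\<Sum>j = 0..<n. det B * (if j = i then 1 else 0) * e j)"
    using i(1) by (auto simp: v_def scalar_prod_def intro!: sum.cong)
  also have "\<dots> = (\<Sum>j = 0..<n. (if j = i then det B * e j else 0))"
    by (intro sum.cong) auto
  finally have "det B = 0" using z i by simp
  then have 0: "poly (char_poly A) x = 0" using pB by simp
  \<comment> \<open>By the Leibniz formula the determinant is built from signs and entries in R[X],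
    which is a subring.\<close>
  have cp: "char_poly A \<in> polys_over R"
  proof -
    have P: "is_subring (polys_over R)" by (rule subring_polys_over[OF R])
    have ent: "char_poly_matrix A $$ (i, j) \<in> polys_over R" if "i < n" "j < n" for i j
      using that A eM c(1) R
      by (auto simp: char_poly_matrix_def polys_over_pCons A_def subring_closed intro!: polys_overI)
    have sgn: "of_int (sign p) \<in> polys_over R" for p :: "nat \<Rightarrow> nat"
      using P by (auto simp: sign_def subring_closed)
    have cA: "char_poly_matrix A \<in> carrier_mat n n" using A by simp
    show ?thesis
      unfolding char_poly_def det_def'[OF cA]
      by (intro subring_sum[OF P] subring_mult[OF P] subring_prod[OF P] sgn ent)
        (auto simp: permutes_in_image)
  qed
  show ?thesis
    unfolding integral_over_alt
    by (rule bexI[of _ "char_poly A"])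
      (use cp 0 degree_monic_char_poly[OF A] in auto)
qed

text \<open>In this form integrality passes to sums, products and towers by combining generating
  sets, without constructing polynomials.\<close>

lemma integral_over_iff_stable_span:
  assumes R: "is_subring R"
  shows "integral_over R x \<longleftrightarrow> (\<exists>M. finite M \<and> 1 \<in> M \<and> (\<forall>m\<in>M. x * m \<in> span_over R M))"
proof
  assume "integral_over R x"
  then obtain p where p: "p \<in> polys_over R" "lead_coeff p = 1" "poly p x = 0"
    by (auto simp: integral_over_alt)
  show "\<exists>M. finite M \<and> 1 \<in> M \<and> (\<forall>m\<in>M. x * m \<in> span_over R M)"
    by (rule stable_span_of_monic[OF R _ _ p(2,3), of "{1}"])
      (use span_over_base[of _ R 1 "{1}"] polys_overD[OF p(1)] in auto)
qed (auto intro: stable_span_imp_integral_over[OF R])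

lemma span_over_1: "is_subring R \<Longrightarrow> m \<in> M \<Longrightarrow> m \<in> span_over R M"
  using span_over_base[of 1 R m M] by (simp add: subring_1)

text \<open>If x maps M into its span and y maps N into its span, then both map the products m * n
  into their span, each acting on its own factor.\<close>

lemma common_stable_span:
  assumes R: "is_subring R" and F: "finite F" "\<And>x. x \<in> F \<Longrightarrow> integral_over R x"
  shows "\<exists>M. finite M \<and> 1 \<in> M \<and> (\<forall>x\<in>F. \<forall>m\<in>M. x * m \<in> span_over R M)"
  using F
proof (induct F)
  case empty
  show ?case by (rule exI[of _ "{1}"]) simp
next
  case (insert x F)
  obtain M where M: "finite M" "1 \<in> M" "\<And>m. m \<in> M \<Longrightarrow> x * m \<in> span_over R M"
    using insert(4)[of x] integral_over_iff_stable_span[OF R] by auto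
  obtain N where N: "finite N" "1 \<in> N" "\<And>x m. x \<in> F \<Longrightarrow> m \<in> N \<Longrightarrow> x * m \<in> span_over R N"
    using insert by auto
  let ?L = "{m * n |m n. m \<in> M \<and> n \<in> N}"
  have "y * (m * n) \<in> span_over R ?L" if "y \<in> insert x F" "m \<in> M" "n \<in> N" for y m n
  proof (cases "y = x")
    case True
    have "(x * m) * n \<in> span_over R ?L"
      by (intro span_over_mult R M span_over_1 that)
    then show ?thesis by (simp add: True algebra_simps)
  next
    case False
    have "m * (y * n) \<in> span_over R ?L"
      using False that(1) by (intro span_over_mult R N span_over_1 that) auto
    then show ?thesis by (simp add: algebra_simps)
  qed
  moreover have "finite ?L" using M(1) N(1) by (simp add: finite_image_set2)
  moreover have "1 \<in> ?L" using M(2) N(2) by (auto intro!: exI[of _ 1])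
  ultimately show ?case by (intro exI[of _ ?L]) blast
qed

lemma integral_over_base: "is_subring R \<Longrightarrow> x \<in> R \<Longrightarrow> integral_over R x"
  unfolding integral_over_iff_stable_span
  using span_over_base[of x R 1 "{1}"] by (intro exI[of _ "{1}"]) auto

text \<open>One equation involves finitely many coefficients, so a single finite span is stable
  under all of them; \<open>stable_span_of_monic\<close> enlarges it to one stable under x.\<close>

lemma integral_over_trans:
  assumes R: "is_subring R" and x: "integral_over C x" and C: "\<And>c. c \<in> C \<Longrightarrow> integral_over R c"
  shows "integral_over R x"
proof -
  obtain p where p: "p \<in> polys_over C" "lead_coeff p = 1" "poly p x = 0"
    using x by (auto simp: integral_over_alt)
  have "range (coeff p) \<subseteq> coeff p ` {..degree p} \<union> {0}"
    by (auto simp: image_def intro: coeff_eq_0 leI)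
  then have "finite (range (coeff p))" by (rule finite_subset) auto
  then obtain M where M: "finite M" "1 \<in> M" "\<forall>x\<in>range (coeff p). \<forall>m\<in>M. x * m \<in> span_over R M"
    using common_stable_span[OF R, of "range (coeff p)"] C polys_overD[OF p(1)] by auto
  show ?thesis
    unfolding integral_over_iff_stable_span[OF R]
    by (rule stable_span_of_monic[OF R M(1,2) p(2,3)]) (use M(3) in auto)
qed

lemma subring_integral_closure:
  assumes R: "is_subring R"
  shows "is_subring {x. integral_over R x}"
proof -
  have *: "integral_over R (x + y) \<and> integral_over R (x * y)"
    if xy: "integral_over R x" "integral_over R y" for x y
  proof -
    obtain M where M: "finite M" "1 \<in> M" "\<And>z m. z \<in> {x, y} \<Longrightarrow> m \<in> M \<Longrightarrow> z * m \<in> span_over R M"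
      using common_stable_span[OF R, of "{x, y}"] xy by (metis finite.emptyI finite_insert insert_iff singletonD)
    \<comment> \<open>Stability has to be extended from generators to the span, because x * m is
      only a combination of generators when y is applied to it.\<close>
    have y: "y * z \<in> span_over R M" if "z \<in> span_over R M" for z
      using that
    proof induct
      case (step r m z)
      have "y * (r * m + z) = r * (y * m) + y * z" by (simp add: algebra_simps)
      moreover have "r * (y * m) + y * z \<in> span_over R M"
        by (intro span_over_add span_over_scale R step M(3)) auto
      ultimately show ?case by simp
    qed (auto intro: span_over.zero)
    have "(x + y) * m \<in> span_over R M \<and> (x * y) * m \<in> span_over R M" if "m \<in> M" for m
      using y[OF M(3)[of x m]] M(3)[of x m] M(3)[of y m] that
      by (auto simp: distrib_right mult.assoc mult.left_commute intro: span_over_add)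
    then show ?thesis
      unfolding integral_over_iff_stable_span[OF R] using M(1,2) by auto
  qed
  have "integral_over R (- 1)" by (intro integral_over_base R subring_closed)
  with * have "integral_over R (- x)" if "integral_over R x" for x
    using that by (metis mult_minus1)
  with * show ?thesis
    unfolding is_subring_def
    using integral_over_base[OF R] R by (auto simp: subring_closed)
qed

section \<open>Adjoining elements to a subring\<close>

lemma subring_ring_adjoin: "is_subring (ring_adjoin S)"
  unfolding ring_adjoin_def is_subring_def by blast

lemma ring_adjoin_subset: "S \<subseteq> ring_adjoin S"
  unfolding ring_adjoin_def by blast

lemma ring_adjoin_least: "is_subring R \<Longrightarrow> S \<subseteq> R \<Longrightarrow> ring_adjoin S \<subseteq> R"
  unfolding ring_adjoin_def by blast

lemma ring_adjoin_mono: "S \<subseteq> S' \<Longrightarrow> ring_adjoin S \<subseteq> ring_adjoin S'"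
  unfolding ring_adjoin_def by blast

lemma ring_adjoin_of_subring: "is_subring R \<Longrightarrow> ring_adjoin R = R"
  unfolding ring_adjoin_def by blast

lemma ring_adjoin_Un_ring_adjoin: "ring_adjoin (ring_adjoin S \<union> T) = ring_adjoin (S \<union> T)"
  using ring_adjoin_subset[of S] ring_adjoin_subset[of "S \<union> T"]
  by (intro subset_antisym ring_adjoin_least subring_ring_adjoin ring_adjoin_mono Un_least)
    (auto intro: subsetD[OF ring_adjoin_mono, of S])

lemma ring_adjoin_single:
  assumes R: "is_subring R"
  shows "ring_adjoin (insert s R) = (\<lambda>p. poly p s) ` polys_over R"
proof (intro subset_antisym ring_adjoin_least)
  show "is_subring ((\<lambda>p. poly p s) ` polys_over R)"
    using subring_polys_over[OF R] unfolding is_subring_def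
    by (auto simp flip: poly_add poly_mult poly_minus intro: image_eqI[of _ _ 0] image_eqI[of _ _ 1])
  have "[:0, 1:] \<in> polys_over R" "\<And>x. x \<in> R \<Longrightarrow> [:x:] \<in> polys_over R"
    using subring_0[OF subring_polys_over[OF R]] by (auto simp: polys_over_pCons subring_closed[OF R])
  then show "insert s R \<subseteq> (\<lambda>p. poly p s) ` polys_over R"
    by (force simp: image_iff)
  show "(\<lambda>p. poly p s) ` polys_over R \<subseteq> ring_adjoin (insert s R)"
    using ring_adjoin_subset[of "insert s R"]
    by (auto intro!: poly_in_subring subring_ring_adjoin elim: polys_over_mono[rotated])
qed

section \<open>Integral multiples and clearing denominators\<close>

lemma
  assumes "is_subring R"
  shows integral_over_add: "\<And>x y. integral_over R x \<Longrightarrow> integral_over R y \<Longrightarrow> integral_over R (x + y)"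
    and integral_over_mult: "\<And>x y. integral_over R x \<Longrightarrow> integral_over R y \<Longrightarrow> integral_over R (x * y)"
  using subring_closed[OF subring_integral_closure[OF assms]] by simp_all

lemma integral_over_prod:
  "is_subring R \<Longrightarrow> (\<And>i. i \<in> I \<Longrightarrow> integral_over R (f i)) \<Longrightarrow> integral_over R (prod f I)"
  using subring_prod[OF subring_integral_closure, of R I f] by auto

lemma integral_over_poly:
  assumes "is_subring R" "p \<in> polys_over R" "integral_over R x"
  shows "integral_over R (poly p x)"
  using poly_in_subring[OF subring_integral_closure[OF assms(1)], of p x] assms
    polys_over_mono[of R "{x. integral_over R x}" p] integral_over_base[OF assms(1)]
  by auto

text \<open>Multiply $p(x) = 0$ by $c^{n-1}$, where $n$ is the degree of $p$.\<close>

lemma integral_over_lead_coeff_mult: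
  assumes R: "is_subring R" and p: "p \<in> polys_over R" "poly p x = 0" "degree p > 0"
  shows "integral_over R (lead_coeff p * x)"
proof -
  define n where "n = degree p"
  define c where "c = lead_coeff p"
  have n: "n > 0" using p(3) by (simp add: n_def)
  define q where "q = monom 1 n + (\<Sum>i<n. monom (coeff p i * c ^ (n - 1 - i)) i)"
  have cR: "c \<in> R" using p(1) by (simp add: c_def polys_overD)
  have cq: "coeff q i = (if i = n then 1 else if i < n then coeff p i * c ^ (n - 1 - i) else 0)" for i
    by (auto simp: q_def coeff_sum)
  have q: "q \<in> polys_over R"
    using R p(1) cR by (auto simp: polys_over_def cq intro!: subring_closed)
  have "degree q \<le> n" by (rule degree_le) (auto simp: cq)
  moreover have "n \<le> degree q" by (rule le_degree) (simp add: cq)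
  ultimately have lq: "lead_coeff q = 1" by (simp add: cq)
  have "poly q (c * x) = (c * x) ^ n + (\<Sum>i<n. coeff p i * c ^ (n - 1 - i) * (c * x) ^ i)"
    by (simp add: q_def poly_sum poly_monom)
  also have "(c * x) ^ n = c ^ (n - 1) * (c * x ^ n)"
    using n by (cases n) (auto simp: power_mult_distrib algebra_simps)
  also have "(\<Sum>i<n. coeff p i * c ^ (n - 1 - i) * (c * x) ^ i) = c ^ (n - 1) * (\<Sum>i<n. coeff p i * x ^ i)"
    unfolding sum_distrib_left
  proof (rule sum.cong)
    fix i assume "i \<in> {..<n}"
    then have "c ^ (n - 1) = c ^ (n - 1 - i) * c ^ i" by (simp flip: power_add)
    then show "coeff p i * c ^ (n - 1 - i) * (c * x) ^ i = c ^ (n - 1) * (coeff p i * x ^ i)"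
      by (simp add: power_mult_distrib algebra_simps)
  qed simp
  also have "c ^ (n - 1) * (c * x ^ n) + c ^ (n - 1) * (\<Sum>i<n. coeff p i * x ^ i) = c ^ (n - 1) * poly p x"
    by (simp add: poly_altdef lessThan_Suc_atMost[symmetric] n_def c_def algebra_simps)
  finally have "poly q (c * x) = 0" using p(2) by simp
  then show ?thesis using q lq by (auto simp: integral_over_alt c_def)
qed

text \<open>The polynomial h p has leading coefficient h and coefficients in the integral closure of
  R. Hence h x is integral over that closure, and so over R.\<close>

lemma integral_over_scaled_poly:
  assumes R: "is_subring R" and h: "integral_over R h"
    and p: "lead_coeff p = 1" "poly p x = 0" "\<And>i. integral_over R (h * coeff p i)"
  shows "integral_over R (h * x)"
proof -
  let ?C = "{x. integral_over R x}"
  have C: "is_subring ?C" by (rule subring_integral_closure[OF R])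
  define q where "q = Polynomial.smult h p"
  show ?thesis
  proof (cases "h = 0 \<or> degree p = 0")
    case True
    then have "h * x = 0"
    proof
      assume "degree p = 0"
      then show ?thesis using p by (auto elim!: degree_eq_zeroE)
    qed simp
    then show ?thesis using integral_over_base[OF R subring_0[OF R]] by simp
  next
    case False
    have "coeff q (degree p) = h" using p(1) by (simp add: q_def)
    then have "lead_coeff q = h" "degree q > 0"
      using False degree_smult_le[of h p] le_degree[of q "degree p"] by (auto simp: q_def)
    moreover have "q \<in> polys_over ?C" using p(3) by (auto simp: q_def polys_over_def)
    moreover have "poly q x = 0" using p(2) by (simp add: q_def)
    ultimately have "integral_over ?C (h * x)"
      using integral_over_lead_coeff_mult[OF C, of q x] by simp
    then show ?thesis by (rule integral_over_trans[OF R]) simp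
  qed
qed

text \<open>The elements that some power of h makes integral over R form a subring containing R and
  S. For x integral over R[S], one power of h serves all coefficients of its equation, and then
  \<open>integral_over_scaled_poly\<close> applies.\<close>

lemma clear_denominators:
  assumes R: "is_subring R" and h: "h \<in> R" and S: "\<And>s. s \<in> S \<Longrightarrow> integral_over R (h * s)"
    and x: "integral_over (ring_adjoin (R \<union> S)) x"
  shows "\<exists>N. integral_over R (h ^ N * x)"
proof -
  have hi: "integral_over R (h ^ n)" for n by (intro integral_over_base R subring_power h)
  let ?L = "{x. \<exists>N. integral_over R (h ^ N * x)}"
  have up: "integral_over R (h ^ M * x)" if "integral_over R (h ^ N * x)" "N \<le> M" for x N M
  proof -
    have "h ^ M * x = h ^ (M - N) * (h ^ N * x)"
      using that(2) by (simp add: mult.assoc[symmetric] flip: power_add)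
    then show ?thesis using integral_over_mult[OF R hi that(1)] by simp
  qed
  have "is_subring ?L"
  proof -
    have "x + y \<in> ?L \<and> x * y \<in> ?L \<and> - x \<in> ?L" if xy: "x \<in> ?L" "y \<in> ?L" for x y
    proof -
      obtain N M where N: "integral_over R (h ^ N * x)" and M: "integral_over R (h ^ M * y)"
        using xy by auto
      have "integral_over R (h ^ (N + M) * x + h ^ (N + M) * y)"
        by (intro integral_over_add R up[OF N] up[OF M]) auto
      moreover have "integral_over R ((h ^ N * x) * (h ^ M * y))"
        by (intro integral_over_mult R N M)
      moreover have "integral_over R (- (h ^ N * x))"
        using subring_uminus[OF subring_integral_closure[OF R], of "h ^ N * x"] N by simp
      ultimately show ?thesis
        by (auto simp: algebra_simps power_add intro: exI[of _ N] exI[of _ "N + M"])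
    qed
    moreover have "x \<in> ?L" if "x \<in> R" for x
      using integral_over_base[OF R that] by (auto intro!: exI[of _ 0])
    moreover from this[of 0] this[of 1] have "0 \<in> ?L" "1 \<in> ?L"
      by (auto simp only: subring_0[OF R] subring_1[OF R])
    ultimately show ?thesis
      unfolding is_subring_def[of ?L] by blast
  qed
  moreover have "R \<union> S \<subseteq> ?L"
    using S integral_over_base[OF R] by (auto intro: exI[of _ 0] exI[of _ 1])
  ultimately have L: "ring_adjoin (R \<union> S) \<subseteq> ?L" by (rule ring_adjoin_least)
  obtain p where p: "p \<in> polys_over (ring_adjoin (R \<union> S))" "lead_coeff p = 1" "poly p x = 0"
    using x by (auto simp: integral_over_alt)
  have "\<exists>N. integral_over R (h ^ N * coeff p i)" for i
    using polys_overD[OF p(1)] L by blast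
  then obtain N where N: "\<And>i. integral_over R (h ^ N i * coeff p i)" by metis
  define M where "M = Max (N ` {..degree p})"
  have "integral_over R (h ^ M * coeff p i)" for i
  proof (cases "i \<le> degree p")
    case True
    then show ?thesis by (intro up[OF N]) (auto simp: M_def)
  next
    case False
    then show ?thesis using integral_over_base[OF R subring_0[OF R]] by (simp add: coeff_eq_0)
  qed
  then show ?thesis using integral_over_scaled_poly[OF R hi p(2,3)] by blast
qed

subsection \<open>Zariski's lemma modulo a prime ideal\<close>

lemma
  assumes "is_ideal I"
  shows ideal_0: "0 \<in> I"
    and ideal_add: "\<And>x y. x \<in> I \<Longrightarrow> y \<in> I \<Longrightarrow> x + y \<in> I"
    and ideal_mult: "\<And>x r. x \<in> I \<Longrightarrow> r * x \<in> I"
    and ideal_mult2: "\<And>x r. x \<in> I \<Longrightarrow> x * r \<in> I"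
  using assms unfolding is_ideal_def by (auto simp: mult.commute)

lemma ideal_uminus: "is_ideal I \<Longrightarrow> x \<in> I \<Longrightarrow> - x \<in> I"
  using ideal_mult[of I x "- 1"] by simp

lemma ideal_diff: "is_ideal I \<Longrightarrow> x \<in> I \<Longrightarrow> y \<in> I \<Longrightarrow> x - y \<in> I"
  using ideal_add[of I x "- y"] ideal_uminus[of I y] by simp

lemma ideal_add_cancel: "is_ideal I \<Longrightarrow> x \<in> I \<Longrightarrow> x + y \<in> I \<longleftrightarrow> y \<in> I"
  using ideal_diff[of I "x + y" x] ideal_add[of I x y] by auto

lemma ideal_diff_cong: "is_ideal I \<Longrightarrow> x - y \<in> I \<Longrightarrow> x \<in> I \<longleftrightarrow> y \<in> I"
  using ideal_add_cancel[of I "x - y" y] by simp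

lemma ideal_sum: "is_ideal I \<Longrightarrow> (\<And>i. i \<in> J \<Longrightarrow> f i \<in> I) \<Longrightarrow> sum f J \<in> I"
  by (induct J rule: infinite_finite_induct) (auto intro: ideal_0 ideal_add)

lemma
  assumes "is_prime_ideal P"
  shows prime_ideal_ideal: "is_ideal P"
    and prime_ideal_1: "1 \<notin> P"
    and prime_ideal_mult: "\<And>x y. x * y \<in> P \<longleftrightarrow> x \<in> P \<or> y \<in> P"
proof -
  show I: "is_ideal P" using assms by (simp add: is_prime_ideal_def)
  show "1 \<notin> P"
    using ideal_mult[OF I, of 1] assms by (auto simp: is_prime_ideal_def)
  show "x * y \<in> P \<longleftrightarrow> x \<in> P \<or> y \<in> P" for x y
    using ideal_mult[OF I, of y x] ideal_mult2[OF I, of x y] assms by (auto simp: is_prime_ideal_def)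
qed

lemma prime_ideal_power: "is_prime_ideal P \<Longrightarrow> x ^ n \<in> P \<Longrightarrow> x \<in> P"
  by (induct n) (auto simp: prime_ideal_1 prime_ideal_mult)

lemma prime_ideal_prod: "finite I \<Longrightarrow> is_prime_ideal P \<Longrightarrow> prod f I \<in> P \<longleftrightarrow> (\<exists>i\<in>I. f i \<in> P)"
  by (induct rule: finite_induct) (auto simp: prime_ideal_1 prime_ideal_mult)

text \<open>Replaces reduction of p modulo I: after the top terms with coefficients in I are
  dropped, the degree and the leading coefficient are those of the reduced polynomial.\<close>

lemma truncate_mod_ideal:
  assumes I: "is_ideal I" and R: "is_subring R" and p: "p \<in> polys_over R" "\<exists>i. coeff p i \<notin> I"
  shows "\<exists>q\<in>polys_over R. lead_coeff q \<notin> I \<and> (\<forall>x. poly p x - poly q x \<in> I)"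
proof -
  define n where "n = (GREATEST i. coeff p i \<notin> I)"
  have bd: "i \<le> degree p" if "coeff p i \<notin> I" for i
    using that ideal_0[OF I] le_degree[of p i] by (cases "coeff p i = 0") auto
  have n: "coeff p n \<notin> I"
    unfolding n_def using p(2) by (rule GreatestI_ex_nat) (rule bd)
  have gt: "coeff p i \<in> I" if "i > n" for i
  proof (rule ccontr)
    assume "coeff p i \<notin> I"
    then have "i \<le> n" unfolding n_def by (rule Greatest_le_nat) (rule bd)
    with that show False by simp
  qed
  define q where "q = (\<Sum>i\<le>n. monom (coeff p i) i)"
  have cq: "coeff q i = (if i \<le> n then coeff p i else 0)" for i
    by (simp add: q_def coeff_sum)
  have "degree q \<le> n" by (rule degree_le) (simp add: cq)
  moreover have "n \<le> degree q"
    using n ideal_0[OF I] by (intro le_degree) (auto simp: cq)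
  ultimately have "lead_coeff q \<notin> I" using n by (simp add: cq)
  moreover have "q \<in> polys_over R"
    using p(1) subring_0[OF R] by (auto simp: polys_over_def cq)
  moreover have "poly p x - poly q x \<in> I" for x
  proof -
    have "poly p x - poly q x = poly (p - q) x" by simp
    also have "\<dots> \<in> I"
      unfolding poly_altdef
      using gt ideal_0[OF I] by (intro ideal_sum I ideal_mult2) (auto simp: cq)
    finally show ?thesis .
  qed
  ultimately show ?thesis by blast
qed

text \<open>The value of the truncated polynomial at x lies in P, hence in R, and can be subtracted
  from the constant term. This leaves an exact equation over R whose leading coefficient is outside
  P.\<close>

lemma algebraic_mod_prime:
  assumes P: "is_prime_ideal P" and R: "is_subring R" "P \<subseteq> R"
    and p: "p \<in> polys_over R" "\<exists>i. coeff p i \<notin> P" "poly p x \<in> P"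
  shows "\<exists>c\<in>R - P. integral_over R (c * x)"
proof -
  note I = prime_ideal_ideal[OF P]
  obtain q where q: "q \<in> polys_over R" "lead_coeff q \<notin> P" "poly p x - poly q x \<in> P"
    using truncate_mod_ideal[OF I R(1) p(1,2)] by blast
  have qP: "poly q x \<in> P" using ideal_diff_cong[OF I q(3)] p(3) by simp
  have deg: "degree q > 0"
  proof (rule ccontr)
    assume "\<not> degree q > 0"
    then show False using q(2) qP by (auto elim!: degree_eq_zeroE)
  qed
  define q' where "q' = q + [:- poly q x:]"
  have "degree q' = degree q" "lead_coeff q' = lead_coeff q"
    using deg by (auto simp: q'_def degree_add_eq_left coeff_pCons split: nat.split)
  moreover have "q' \<in> polys_over R"
    using q(1) R qP unfolding q'_def
    by (intro subring_add subring_polys_over)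
      (auto simp: polys_over_pCons intro: subring_uminus subring_0 subring_polys_over)
  moreover have "poly q' x = 0" by (simp add: q'_def)
  ultimately have "integral_over R (lead_coeff q * x)"
    using integral_over_lead_coeff_mult[OF R(1), of q' x] deg by simp
  then show ?thesis using q(1,2) by (auto dest: polys_overD)
qed

text \<open>Divide the integral equation of $e$ by powers of $e$ until its constant term leaves $P$.\<close>

lemma integral_cofactor_mod_prime:
  assumes P: "is_prime_ideal P" and R: "is_subring R" "P \<subseteq> R"
    and e: "integral_over R e" "e \<notin> P"
  shows "\<exists>g. integral_over R g \<and> e * g \<in> R - P"
proof -
  note I = prime_ideal_ideal[OF P]
  \<comment> \<open>The value at e is required only modulo P: cancelling e in a product that lies in
    P yields membership in P, not an equation.\<close>
  have "\<exists>g. integral_over R g \<and> e * g \<in> R - P"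
    if "p \<in> polys_over R" "lead_coeff p = 1" "poly p e \<in> P" for p
    using that
  proof (induct p rule: pCons_induct)
    case 0
    then show ?case using prime_ideal_1[OF P] ideal_mult[OF I ideal_0[OF I]] by simp
  next
    case (pCons a p)
    have p: "p \<in> polys_over R" and a: "a \<in> R" using pCons.prems(1) by (auto simp: polys_over_pCons)
    have pe: "a + e * poly p e \<in> P" using pCons.prems(3) by simp
    show ?case
    proof (cases "a \<in> P")
      case True
      then have "e * poly p e \<in> P" using pe ideal_add_cancel[OF I] by blast
      then have *: "poly p e \<in> P" using e(2) prime_ideal_mult[OF P] by blast
      have "p \<noteq> 0"
        using pCons.prems(2) True prime_ideal_1[OF P] by auto
      then show ?thesis using pCons.hyps(2)[OF p _ *] pCons.prems(2) by simp
    next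
      case False
      \<comment> \<open>The cofactor is \<open>poly p e\<close>: its product with e differs from -a
        by an element of P, so it lies in R but not in P.\<close>
      have "e * poly p e = (a + e * poly p e) - a" by simp
      moreover have "(a + e * poly p e) - a \<in> R" using pe R a by (intro subring_diff) auto
      moreover have "(a + e * poly p e) - a \<notin> P"
        using ideal_add_cancel[OF I pe, of "- a"] ideal_uminus[OF I, of "- a"] False by auto
      ultimately show ?thesis
        using integral_over_poly[OF R(1) p e(1)] by auto
    qed
  qed
  moreover obtain p where "p \<in> polys_over R" "lead_coeff p = 1" "poly p e = 0"
    using e(1) by (auto simp: integral_over_alt)
  ultimately show ?thesis using ideal_0[OF I] by simp
qed

text \<open>With $f = 1 + s h$ one has $s h \equiv -1$ modulo $f$, so if $f$ divides $r^m h^M$ then it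
  divides $r^m$; this is impossible for degree reasons when $s$ is transcendental modulo $P$.\<close>

lemma not_invertible_mod_prime:
  assumes P: "is_prime_ideal P" and R: "is_subring R" "P \<subseteq> R"
    and s: "\<And>p. p \<in> polys_over R \<Longrightarrow> poly p s \<in> P \<Longrightarrow> (\<forall>i. coeff p i \<in> P)"
    and h: "h \<in> ring_adjoin (insert s R)" "h \<notin> P"
    and r: "r \<in> R" "r \<notin> P"
    and z: "integral_over (ring_adjoin (insert s R)) z" "(1 + s * h) * z = r * h ^ N"
  shows False
proof -
  note I = prime_ideal_ideal[OF P]
  define R1 where "R1 = ring_adjoin (insert s R)"
  have R1: "is_subring R1" by (simp add: R1_def subring_ring_adjoin)
  have R1_eq: "R1 = (\<lambda>p. poly p s) ` polys_over R" by (simp add: R1_def ring_adjoin_single[OF R(1)])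
  have sub: "s \<in> R1" "R \<subseteq> R1" using ring_adjoin_subset[of "insert s R"] by (auto simp: R1_def)
  have lift: "\<exists>q\<in>polys_over R. lead_coeff q \<notin> P \<and> x - poly q s \<in> P" if x: "x \<in> R1" "x \<notin> P" for x
  proof -
    obtain p where p: "p \<in> polys_over R" "x = poly p s" using x(1) by (auto simp: R1_eq)
    have "\<exists>i. coeff p i \<notin> P"
    proof (rule ccontr)
      assume "\<not> ?thesis"
      then have "poly p s \<in> P" unfolding poly_altdef by (intro ideal_sum I ideal_mult2) auto
      then show False using x(2) p(2) by simp
    qed
    then show ?thesis using truncate_mod_ideal[OF I R(1) p(1)] p(2) by blast
  qed
  define f where "f = 1 + s * h"
  have hR: "h \<in> R1" using h(1) by (simp add: R1_def)
  have fR: "f \<in> R1" unfolding f_def by (intro subring_closed R1 sub hR)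
  obtain p where p: "p \<in> polys_over R1" "lead_coeff p = 1" "poly p z = 0"
    using z(1) by (auto simp: integral_over_alt R1_def)
  define n where "n = degree p"
  have fz: "f * z = r * h ^ N" using z(2) by (simp add: f_def)
  have fzR: "f * z \<in> R1" unfolding fz using r(1) sub by (intro subring_closed R1 hR) auto
  \<comment> \<open>Since z is merely integral over R[s], divisibility by f has to be brought down
    to R[s]. In f^n times the equation of z, every term except (f z)^n keeps a factor f, and f z = r
    h^N lies in R[s].\<close>
  have "\<exists>g\<in>R1. (r * h ^ N) ^ n = f * g"
  proof (rule bexI)
    have "f ^ n * (z ^ n + (\<Sum>i<n. coeff p i * z ^ i)) = 0"
      using p(3) monic_power_eq[OF p(2), of z] by (simp add: n_def)
    then have "f ^ n * z ^ n = - (\<Sum>i<n. coeff p i * (f ^ n * z ^ i))"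
      by (simp add: eq_neg_iff_add_eq_0 distrib_left sum_distrib_left mult.left_commute)
    also have "\<dots> = - (\<Sum>i<n. f * (coeff p i * f ^ (n - 1 - i) * (f * z) ^ i))"
    proof (intro arg_cong[where f = uminus] sum.cong)
      fix i assume "i \<in> {..<n}"
      then have "f ^ n = f * (f ^ (n - 1 - i) * f ^ i)"
        by (simp flip: power_add power_Suc)
      then show "coeff p i * (f ^ n * z ^ i) = f * (coeff p i * f ^ (n - 1 - i) * (f * z) ^ i)"
        by (simp add: power_mult_distrib algebra_simps)
    qed simp
    finally show "(r * h ^ N) ^ n = f * - (\<Sum>i<n. coeff p i * f ^ (n - 1 - i) * (f * z) ^ i)"
      by (simp add: fz[symmetric] power_mult_distrib sum_distrib_left)
    show "- (\<Sum>i<n. coeff p i * f ^ (n - 1 - i) * (f * z) ^ i) \<in> R1"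
      by (intro subring_closed R1 fR fzR polys_overD[OF p(1)])
  qed
  then obtain g where g: "g \<in> R1" "(r * h ^ N) ^ n = f * g" by blast
  have "\<exists>g\<in>R1. (s * h) ^ M = (- 1) ^ M + f * g" for M
  proof (induct M)
    case 0
    show ?case by (rule bexI[of _ 0]) (auto simp: subring_closed R1)
  next
    case (Suc M)
    then obtain g where g: "g \<in> R1" "(s * h) ^ M = (- 1) ^ M + f * g" by blast
    have "(s * h) ^ Suc M = (f - 1) * ((- 1) ^ M + f * g)" using g(2) by (simp add: f_def)
    also have "\<dots> = (- 1) ^ Suc M + f * ((- 1) ^ M + (f - 1) * g)" by (simp add: algebra_simps)
    finally show ?case using g(1) fR R1 by (intro bexI[of _ "(- 1) ^ M + (f - 1) * g"]) (auto intro!: subring_closed)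
  qed
  from this[of "N * n"] obtain g2 where g2: "g2 \<in> R1" "(s * h) ^ (N * n) = (- 1) ^ (N * n) + f * g2" by blast
  have "s ^ (N * n) * (f * g) = r ^ n * (s * h) ^ (N * n)"
    unfolding g(2)[symmetric] by (simp add: power_mult_distrib power_mult algebra_simps)
  also have "\<dots> = r ^ n * (- 1) ^ (N * n) + f * (r ^ n * g2)"
    unfolding g2(2) by (simp add: algebra_simps)
  finally have "r ^ n * (- 1) ^ (N * n) = f * (s ^ (N * n) * g - r ^ n * g2)"
    by (simp add: algebra_simps)
  \<comment> \<open>Multiplying by the sign once more makes it square to 1, leaving r^n as a
    multiple of f in R[s].\<close>
  then have "r ^ n * ((- 1) ^ (N * n) * (- 1) ^ (N * n)) = f * ((s ^ (N * n) * g - r ^ n * g2) * (- 1) ^ (N * n))"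
    by (simp only: mult.assoc[symmetric])
  moreover define G where "G = (s ^ (N * n) * g - r ^ n * g2) * (- 1) ^ (N * n)"
  ultimately have rG: "r ^ n = f * G" by (simp flip: power_mult_distrib)
  have "r \<in> R1" using r(1) sub by auto
  then have GR: "G \<in> R1" unfolding G_def by (intro subring_closed R1 sub g g2)
  have rn: "r ^ n \<notin> P" using r(2) prime_ideal_power[OF P] by blast
  then have GP: "G \<notin> P" using rG prime_ideal_mult[OF P] by auto
  obtain q where q: "q \<in> polys_over R" "lead_coeff q \<notin> P" "G - poly q s \<in> P"
    using lift[OF GR GP] by blast
  obtain H where H: "H \<in> polys_over R" "lead_coeff H \<notin> P" "h - poly H s \<in> P"
    using lift[OF hR h(2)] by blast
  \<comment> \<open>F represents f = 1 + s h modulo P. As H is nonzero, F has positive degree and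
    inherits the leading coefficient of H.\<close>
  define F where "F = pCons 1 H"
  have H0: "H \<noteq> 0" using H(2) ideal_0[OF I] by auto
  have F: "F \<in> polys_over R" "lead_coeff F \<notin> P" "degree F > 0"
    using H H0 by (auto simp: F_def polys_over_pCons subring_closed R)
  \<comment> \<open>u(s) lies in P, so all coefficients of u do. In degree
    \<open>degree F + degree q\<close>, which is positive, the constant r^n does not contribute and
    only minus the product of the leading coefficients remains.\<close>
  define u where "u = [:r ^ n:] - F * q"
  have u: "u \<in> polys_over R"
    unfolding u_def using F(1) q(1) r(1) R(1)
    by (intro subring_diff subring_mult subring_polys_over)
      (auto simp: polys_over_pCons intro: subring_power subring_0 subring_polys_over)
  have "f - poly F s = s * (h - poly H s)" by (simp add: f_def F_def algebra_simps)
  then have fP: "f - poly F s \<in> P" using ideal_mult[OF I H(3)] by simp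
  have "poly u s = (f - poly F s) * G + poly F s * (G - poly q s)"
    by (simp add: u_def rG algebra_simps)
  also have "\<dots> \<in> P" by (intro ideal_add ideal_mult ideal_mult2 I fP q)
  finally have "coeff u (degree F + degree q) \<in> P" using s[OF u] by blast
  moreover have "coeff u (degree F + degree q) = - (lead_coeff F * lead_coeff q)"
    using F(3) by (simp add: u_def coeff_mult_degree_sum coeff_pCons split: nat.split)
  ultimately have "lead_coeff F * lead_coeff q \<in> P" using ideal_uminus[OF I] by fastforce
  then show False using F(2) q(2) prime_ideal_mult[OF P] by blast
qed

text \<open>Zariski's lemma for the algebra $A/P$ over $R$, where every element outside $P$ is
  invertible up to an element of $R - P$. The hypothesis $P \subseteq R$ turns relations modulo
  $P$ into equations.\<close>

lemma zariski_over:
  assumes "finite S" "is_prime_ideal P" "is_subring R" "P \<subseteq> R"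
    and "\<And>x. integral_over (ring_adjoin (R \<union> S)) x"
    and "\<And>x. x \<notin> P \<Longrightarrow> \<exists>y. x * y \<in> R - P"
  shows "\<exists>c\<in>R - P. integral_over R (c * x)"
  using assms
proof (induct S arbitrary: R x rule: finite_induct)
  case empty
  then show ?case
    using prime_ideal_1[of P] by (intro bexI[of _ 1]) (auto simp: ring_adjoin_of_subring subring_1)
next
  case (insert s S)
  note P = insert.prems(1) and R = insert.prems(2,3)
  define R1 where "R1 = ring_adjoin (insert s R)"
  have R1: "is_subring R1" by (simp add: R1_def subring_ring_adjoin)
  have sub: "s \<in> R1" "R \<subseteq> R1" using ring_adjoin_subset[of "insert s R"] by (auto simp: R1_def)
  have int1: "integral_over (ring_adjoin (R1 \<union> S)) x" for x
    using insert.prems(4)[of x] ring_adjoin_Un_ring_adjoin[of "insert s R" S] by (simp add: R1_def)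
  have inv1: "\<exists>y. x * y \<in> R1 - P" if "x \<notin> P" for x
    using insert.prems(5)[OF that] sub(2) by blast
  have P1: "P \<subseteq> R1" using R(2) sub(2) by blast
  have IH: "\<exists>c\<in>R1 - P. integral_over R1 (c * x)" for x
    by (rule insert.hyps(3)[OF P R1 P1 int1 inv1])
  show ?case
  proof (cases "\<exists>c\<in>R - P. integral_over R (c * s)")
    case True
    \<comment> \<open>Here s is algebraic modulo P, and the multiplier c in R[s] must be traded for
      one in R. Powers of c0 make c integral over R, and a cofactor g then carries the result into R
      - P.\<close>
    then obtain c0 where c0: "c0 \<in> R" "c0 \<notin> P" "integral_over R (c0 * s)" by auto
    have clear: "\<exists>N. integral_over R (c0 ^ N * x)" if "integral_over R1 x" for x
      using clear_denominators[OF R(1) c0(1), of "{s}" x] c0(3) that by (simp add: R1_def)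
    obtain c where c: "c \<in> R1" "c \<notin> P" "integral_over R1 (c * x)" using IH by blast
    obtain N where N: "integral_over R (c0 ^ N * (c * x))" using clear[OF c(3)] by blast
    obtain M where M: "integral_over R (c0 ^ M * c)"
      using clear[OF integral_over_base[OF R1 c(1)]] by blast
    have "c0 ^ M * c \<notin> P"
      using c(2) c0(2) prime_ideal_mult[OF P] prime_ideal_power[OF P] by blast
    then obtain g where g: "integral_over R g" "c0 ^ M * c * g \<in> R - P"
      using integral_cofactor_mod_prime[OF P R M] by blast
    have "integral_over R (g * c0 ^ M * (c0 ^ N * (c * x)))"
      by (intro integral_over_mult R N g integral_over_base subring_power c0)
    then have "integral_over R ((c0 ^ N * (c0 ^ M * c * g)) * x)" by (simp add: algebra_simps)
    moreover have "c0 ^ N * (c0 ^ M * c * g) \<in> R - P"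
      using g(2) c0(1,2) prime_ideal_mult[OF P] prime_ideal_power[OF P]
      by (auto intro: subring_mult subring_power R)
    ultimately show ?thesis by blast
  next
    case False
    then have tr: "\<forall>i. coeff p i \<in> P" if "p \<in> polys_over R" "poly p s \<in> P" for p
      using algebraic_mod_prime[OF P R that(1) _ that(2)] by blast
    obtain c where c: "\<And>x. c x \<in> R1" "\<And>x. c x \<notin> P" "\<And>x. integral_over R1 (c x * x)"
      using IH by (metis DiffE)
    \<comment> \<open>A common denominator for the generators S over R[s]. Powers of h then clear
      the denominators of all of A, in particular of an inverse of 1 + s h up to R - P, which
      \<open>not_invertible_mod_prime\<close> excludes.\<close>
    define h where "h = prod c S"
    have h: "h \<in> R1" "h \<notin> P"
      using c insert.hyps(1) R1 prime_ideal_prod[OF insert.hyps(1) P, of c]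
      by (auto simp: h_def intro: subring_prod)
    have hS: "integral_over R1 (h * t)" if "t \<in> S" for t
    proof -
      have "h * t = prod c (S - {t}) * (c t * t)"
        using that insert.hyps(1) by (simp add: h_def prod.remove[of S t] algebra_simps)
      then show ?thesis
        by (simp add: integral_over_mult R1 c integral_over_prod integral_over_base[OF R1])
    qed
    have "1 + s * h \<notin> P"
    proof
      assume *: "1 + s * h \<in> P"
      obtain p where p: "p \<in> polys_over R" "h = poly p s"
        using h(1) by (auto simp: R1_def ring_adjoin_single[OF R(1)])
      have "pCons 1 p \<in> polys_over R" using p(1) by (simp add: polys_over_pCons subring_1 R)
      then have "\<forall>i. coeff (pCons 1 p) i \<in> P" using tr[of "pCons 1 p"] * p(2) by simp
      then have "coeff (pCons 1 p) 0 \<in> P" by blast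
      then show False using prime_ideal_1[OF P] by simp
    qed
    then obtain y where y: "(1 + s * h) * y \<in> R - P" using insert.prems(5) by blast
    obtain N where N: "integral_over R1 (h ^ N * y)"
      using clear_denominators[OF R1 h(1) hS int1] by blast
    have "(1 + s * h) * (h ^ N * y) = ((1 + s * h) * y) * h ^ N" by (simp add: algebra_simps)
    with not_invertible_mod_prime[OF P R tr h(1)[unfolded R1_def] h(2) _ _ N[unfolded R1_def] this] y
    have False by blast
    then show ?thesis ..
  qed
qed

section \<open>Base rings that need not contain the prime ideal\<close>

lemma subring_Un_ideal:
  assumes R: "is_subring R" and I: "is_ideal I"
  shows "is_subring {r + x |r x. r \<in> R \<and> x \<in> I}"
proof -
  define T where "T = {r + x |r x. r \<in> R \<and> x \<in> I}"
  have TI: "r + x \<in> T" if "r \<in> R" "x \<in> I" for r x using that by (auto simp: T_def)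
  have "a + b \<in> T \<and> a * b \<in> T \<and> - a \<in> T" if ab: "a \<in> T" "b \<in> T" for a b
  proof -
    obtain r x s y where r: "r \<in> R" "x \<in> I" "s \<in> R" "y \<in> I" "a = r + x" "b = s + y"
      using ab by (auto simp: T_def)
    have "r + s + (x + y) \<in> T" "r * s + (r * y + s * x + x * y) \<in> T" "- r + - x \<in> T"
      by (intro TI subring_add[OF R] subring_mult[OF R] subring_uminus[OF R]
          ideal_add[OF I] ideal_mult[OF I] ideal_uminus[OF I] r)+
    then show ?thesis by (simp add: r(5,6) algebra_simps)
  qed
  moreover have "0 \<in> T" "1 \<in> T"
    using TI[OF subring_0[OF R] ideal_0[OF I]] TI[OF subring_1[OF R] ideal_0[OF I]] by simp_all
  ultimately have "is_subring T" unfolding is_subring_def by simp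
  then show ?thesis by (simp add: T_def)
qed

text \<open>The ring R + P contains P, so \<open>zariski_over\<close> applies to it. Expanding the
  monic equation of c x in powers of x and replacing each coefficient by a representative in R gives
  a relation modulo P.\<close>

lemma zariski_mod_prime:
  assumes P: "is_prime_ideal P" and R: "is_subring R" and S: "finite S"
    and int: "\<And>x. integral_over (ring_adjoin (R \<union> S)) x"
    and inv: "\<And>x. x \<notin> P \<Longrightarrow> \<exists>y. \<exists>r\<in>R - P. x * y - r \<in> P"
  shows "\<exists>q\<in>polys_over R. (\<exists>i. coeff q i \<notin> P) \<and> poly q x \<in> P"
proof -
  note I = prime_ideal_ideal[OF P]
  define RP where "RP = {r + x |r x. r \<in> R \<and> x \<in> P}"
  have RP: "is_subring RP" unfolding RP_def by (rule subring_Un_ideal[OF R I])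
  have sub: "R \<subseteq> RP" "P \<subseteq> RP"
    unfolding RP_def using ideal_0[OF I] subring_0[OF R]
    by (auto intro: exI[of _ 0]) (metis add.right_neutral)
  have "integral_over (ring_adjoin (RP \<union> S)) x" for x
    by (rule integral_over_mono[OF ring_adjoin_mono int]) (use sub in auto)
  moreover have "\<exists>y. x * y \<in> RP - P" if x: "x \<notin> P" for x
  proof -
    obtain y r where r: "r \<in> R" "r \<notin> P" "x * y - r \<in> P" using inv[OF x] by blast
    have "x * y = r + (x * y - r)" by simp
    then have "x * y \<in> RP" using r unfolding RP_def by blast
    moreover have "x * y \<notin> P" using ideal_diff_cong[OF I r(3)] r(2) by simp
    ultimately show ?thesis by blast
  qed
  ultimately obtain c where c: "c \<in> RP" "c \<notin> P" "integral_over RP (c * x)"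
    using zariski_over[OF S P RP sub(2), of x] by blast
  obtain p where p: "p \<in> polys_over RP" "lead_coeff p = 1" "poly p (c * x) = 0"
    using c(3) by (auto simp: integral_over_alt)
  define n where "n = degree p"
  have "coeff p i * c ^ i \<in> RP" for i
    using polys_overD[OF p(1)] c(1) by (intro subring_closed RP)
  then have "\<exists>r\<in>R. coeff p i * c ^ i - r \<in> P" for i
    unfolding RP_def mem_Collect_eq by (metis add_diff_cancel_left')
  then obtain r where r: "\<And>i. r i \<in> R" "\<And>i. coeff p i * c ^ i - r i \<in> P" by metis
  define q where "q = (\<Sum>i\<le>n. monom (r i) i)"
  have cq: "coeff q i = (if i \<le> n then r i else 0)" for i
    by (simp add: q_def coeff_sum)
  have "q \<in> polys_over R" using r(1) subring_0[OF R] by (auto simp: polys_over_def cq)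
  \<comment> \<open>The coefficient of degree n is congruent to c^n, because p is monic, and c is
    outside P.\<close>
  moreover have "coeff q n \<notin> P"
    using ideal_diff_cong[OF I r(2), of n] c(2) p(2) prime_ideal_power[OF P, of c n]
    by (auto simp: cq n_def)
  moreover have "poly q x \<in> P"
  proof -
    have "poly p (c * x) - poly q x = (\<Sum>i\<le>n. (coeff p i * c ^ i - r i) * x ^ i)"
      by (simp add: poly_altdef[of p] n_def q_def poly_sum poly_monom sum_subtractf[symmetric]
        power_mult_distrib algebra_simps)
    also have "\<dots> \<in> P" by (intro ideal_sum I ideal_mult2 r)
    finally have "- poly q x \<in> P" using p(3) by simp
    then show ?thesis using ideal_uminus[OF I] by fastforce
  qed
  ultimately show ?thesis by blast
qed

subsection \<open>Algebraic dependence in dimension one\<close>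

lemma ideal_insert:
  assumes I: "is_ideal I"
  shows "is_ideal {p + x * y |p y. p \<in> I}"
proof -
  have "\<exists>t z. p + x * y + (q + x * w) = t + x * z \<and> t \<in> I"
    "\<exists>t z. r * (p + x * y) = t + x * z \<and> t \<in> I"
    if "p \<in> I" "q \<in> I" for p q y w r
  proof -
    show "\<exists>t z. p + x * y + (q + x * w) = t + x * z \<and> t \<in> I"
      by (rule exI[of _ "p + q"], rule exI[of _ "y + w"])
        (use that ideal_add[OF I] in \<open>auto simp: algebra_simps\<close>)
    show "\<exists>t z. r * (p + x * y) = t + x * z \<and> t \<in> I"
      by (rule exI[of _ "r * p"], rule exI[of _ "r * y"])
        (use that ideal_mult[OF I] in \<open>auto simp: algebra_simps\<close>)
  qed
  moreover have "\<exists>t z. 0 = t + x * z \<and> t \<in> I"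
    by (rule exI[of _ 0], rule exI[of _ 0]) (simp add: ideal_0[OF I])
  ultimately show ?thesis unfolding is_ideal_def by blast
qed

lemma ideal_insert_superset:
  assumes I: "is_ideal I"
  shows "I \<subseteq> {p + x * y |p y. p \<in> I}" "x \<in> {p + x * y |p y. p \<in> I}"
proof -
  show "I \<subseteq> {p + x * y |p y. p \<in> I}"
  proof
    fix p assume "p \<in> I"
    then have "p = p + x * 0 \<and> p \<in> I" by simp
    then show "p \<in> {p + x * y |p y. p \<in> I}" by blast
  qed
  have "x = 0 + x * 1 \<and> 0 \<in> I" by (simp add: ideal_0[OF I])
  then show "x \<in> {p + x * y |p y. p \<in> I}" by blast
qed

text \<open>The last conclusion says that A/P becomes a field when T is inverted; this is how the
  invertibility hypothesis of Zariski's lemma is met. With \<open>T = {1}\<close>, P is a maximal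
  ideal.\<close>

lemma exists_ideal_maximal_avoiding:
  assumes I: "is_ideal I" and IT: "I \<inter> T = {}"
    and T: "1 \<in> T" "\<And>x y. x \<in> T \<Longrightarrow> y \<in> T \<Longrightarrow> x * y \<in> T"
  obtains P where "is_prime_ideal P" "I \<subseteq> P" "P \<inter> T = {}"
    "\<And>x. x \<notin> P \<Longrightarrow> \<exists>y. \<exists>t\<in>T. x * y - t \<in> P"
proof -
  define F where "F = {J. is_ideal J \<and> I \<subseteq> J \<and> J \<inter> T = {}}"
  have "\<exists>M\<in>F. \<forall>X\<in>F. M \<subseteq> X \<longrightarrow> X = M"
  proof (rule subset_Zorn_nonempty)
    show "F \<noteq> {}" using I IT by (auto simp: F_def)
    fix C assume C: "C \<noteq> {}" "subset.chain F C"
    have id: "is_ideal J" "I \<subseteq> J" "J \<inter> T = {}" if "J \<in> C" for J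
      using C(2) that by (auto simp: F_def subset.chain_def)
    have "is_ideal (\<Union>C)"
      unfolding is_ideal_def
    proof (intro conjI ballI allI)
      show "0 \<in> \<Union>C" using C(1) ideal_0[OF id(1)] by blast
      show "x + y \<in> \<Union>C" if xy: "x \<in> \<Union>C" "y \<in> \<Union>C" for x y
      proof -
        obtain J1 J2 where J: "J1 \<in> C" "x \<in> J1" "J2 \<in> C" "y \<in> J2" using xy by blast
        then have "J1 \<subseteq> J2 \<or> J2 \<subseteq> J1" using C(2) unfolding subset.chain_def by blast
        then show ?thesis using J ideal_add[OF id(1)] by blast
      qed
      show "r * x \<in> \<Union>C" if "x \<in> \<Union>C" for x r
        using that ideal_mult[OF id(1)] by (meson Union_iff)
    qed
    moreover have "I \<subseteq> \<Union>C" using C(1) id(2) by blast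
    moreover have "\<Union>C \<inter> T = {}" using id(3) by blast
    ultimately show "\<Union>C \<in> F" by (simp add: F_def)
  qed
  then obtain P where PF: "P \<in> F" and max: "\<And>X. X \<in> F \<Longrightarrow> P \<subseteq> X \<Longrightarrow> X = P"
    by blast
  then have P: "is_ideal P" "I \<subseteq> P" "P \<inter> T = {}" by (simp_all add: F_def)
  then have mx: "J = P" if "is_ideal J" "P \<subseteq> J" "J \<inter> T = {}" for J
    using max[of J] that by (simp add: F_def)
  have inv: "\<exists>y. \<exists>t\<in>T. x * y - t \<in> P" if x: "x \<notin> P" for x
  proof -
    let ?J = "{p + x * y |p y. p \<in> P}"
    have "?J \<noteq> P" using ideal_insert_superset(2)[OF P(1), of x] x by blast
    then have "?J \<inter> T \<noteq> {}"
      using mx[OF ideal_insert[OF P(1)] ideal_insert_superset(1)[OF P(1)]] by blast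
    then obtain p y where p: "p \<in> P" "p + x * y \<in> T" by blast
    have "x * y - (p + x * y) \<in> P" using ideal_uminus[OF P(1) p(1)] by simp
    then show ?thesis using p(2) by blast
  qed
  have "x \<in> P \<or> y \<in> P" if xy: "x * y \<in> P" for x y
  proof (rule ccontr)
    assume "\<not> ?thesis"
    then obtain x' t y' u where t: "t \<in> T" "x * x' - t \<in> P" and u: "u \<in> T" "y * y' - u \<in> P"
      using inv by meson
    \<comment> \<open>Modulo P, t u is congruent to (x x')(y y'), which contains the factor x y in
      P.\<close>
    have "t * u = (x * y) * (x' * y') - ((x * x' - t) * (y * y') + (y * y' - u) * t)"
      by (simp add: algebra_simps)
    also have "\<dots> \<in> P" by (intro ideal_diff ideal_add ideal_mult2 P xy t u)
    finally show False using T(2)[OF t(1) u(1)] P(3) by blast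
  qed
  then have "is_prime_ideal P" using P(1,3) T(1) by (auto simp: is_prime_ideal_def)
  then show thesis using that P inv by blast
qed

lemma krull_dim_ge:
  fixes P :: "nat \<Rightarrow> 'a::comm_ring_1 set"
  assumes "\<And>i. i \<le> n \<Longrightarrow> is_prime_ideal (P i)" "\<And>i. i < n \<Longrightarrow> P i \<subset> P (Suc i)"
  shows "enat n \<le> krull_dim TYPE('a)"
proof -
  have "(\<forall>i\<le>n. is_prime_ideal (P i)) \<and> (\<forall>i<n. P i \<subset> P (Suc i))" using assms by simp
  then show ?thesis unfolding krull_dim_def by (intro Sup_upper) auto
qed

lemma algebraically_dependent:
  fixes K :: "'a::idom set"
  assumes K: "is_subfield K" and fe: "finite_expansion K" and dim: "krull_dim TYPE('a) = 1"
    and u: "\<And>p. p \<in> polys_over K \<Longrightarrow> poly p u = 0 \<Longrightarrow> p = 0"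
  shows "\<exists>q\<in>polys_over (ring_adjoin (insert u K)). q \<noteq> 0 \<and> poly q v = 0"
proof (rule ccontr)
  assume indep: "\<not> ?thesis"
  have KR: "is_subring K" using K by (simp add: is_subfield_def)
  obtain S where S: "finite S" "\<And>a. integral_over (ring_adjoin (K \<union> S)) a"
    using fe by (auto simp: finite_expansion_def)
  define R where "R = ring_adjoin (insert u K)"
  have R: "is_subring R" by (simp add: R_def subring_ring_adjoin)
  have KsR: "K \<subseteq> R" using ring_adjoin_subset[of "insert u K"] by (auto simp: R_def)
  have 0: "is_ideal {0::'a}" by (simp add: is_ideal_def)
  have prime0: "is_prime_ideal {0::'a}"
    using 0 by (auto simp: is_prime_ideal_def) (metis UNIV_I one_neq_zero singletonD)
  obtain P where P: "is_prime_ideal P" "P \<inter> (R - {0}) = {}"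
    and inv: "\<And>x. x \<notin> P \<Longrightarrow> \<exists>y. \<exists>t\<in>R - {0}. x * y - t \<in> P"
    by (rule exists_ideal_maximal_avoiding[OF 0, of "R - {0}"])
      (use R in \<open>auto simp: subring_closed\<close>)
  note I = prime_ideal_ideal[OF P(1)]
  have intR: "integral_over (ring_adjoin (R \<union> S)) x" for x
    by (rule integral_over_mono[OF ring_adjoin_mono S(2)]) (use KsR in auto)
  have "\<exists>y. \<exists>t\<in>R - P. x * y - t \<in> P" if "x \<notin> P" for x
    using inv[OF that] P(2) by blast
  from zariski_mod_prime[OF P(1) R S(1) intR this]
  obtain q where q: "q \<in> polys_over R" "\<exists>i. coeff q i \<notin> P" "poly q v \<in> P" by blast
  have "P \<noteq> {0}"
  proof
    assume "P = {0}"
    then have "q \<noteq> 0" "poly q v = 0" using q by auto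
    then show False using indep q(1) by (auto simp: R_def)
  qed
  \<comment> \<open>A relation for u over K modulo P has its value in the intersection of P with
    K[u], which is 0. It is thus an exact equation and contradicts the transcendence of u.\<close>
  have "\<not> (\<forall>x. x \<notin> P \<longrightarrow> (\<exists>y. x * y - 1 \<in> P))"
  proof
    assume *: "\<forall>x. x \<notin> P \<longrightarrow> (\<exists>y. x * y - 1 \<in> P)"
    have "\<exists>y. \<exists>r\<in>K - P. x * y - r \<in> P" if "x \<notin> P" for x
      using * that subring_1[OF KR] prime_ideal_1[OF P(1)] by blast
    from zariski_mod_prime[OF P(1) KR S(1) S(2) this]
    obtain q where q: "q \<in> polys_over K" "\<exists>i. coeff q i \<notin> P" "poly q u \<in> P" by blast
    have "poly q u \<in> R" using q(1) by (auto simp: R_def ring_adjoin_single[OF KR])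
    then have "q = 0" using u[OF q(1)] q(3) P(2) by blast
    then show False using q(2) ideal_0[OF I] by simp
  qed
  then obtain x where x: "x \<notin> P" "\<And>y. x * y - 1 \<notin> P" by blast
  let ?J = "{p + x * y |p y. p \<in> P}"
  have J1: "?J \<inter> {1} = {}"
  proof -
    have "1 \<notin> ?J"
    proof
      assume "1 \<in> ?J"
      then obtain p y where p: "p \<in> P" "1 = p + x * y" by blast
      then have "x * y - 1 = - p" by (simp add: algebra_simps)
      then show False using x(2)[of y] ideal_uminus[OF I p(1)] by simp
    qed
    then show ?thesis by simp
  qed
  obtain M where M: "is_prime_ideal M" "?J \<subseteq> M"
    by (rule exists_ideal_maximal_avoiding[OF ideal_insert[OF I] J1]) auto
  have PM: "P \<subset> M"
    using M(2) x(1) ideal_insert_superset[OF I, of x] by blast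
  have P0: "{0} \<subset> P" using \<open>P \<noteq> {0}\<close> ideal_0[OF I] by blast
  define Q where "Q i = (if i = 0 then {0} else if i = 1 then P else M)" for i :: nat
  have "enat 2 \<le> krull_dim TYPE('a)"
  proof (rule krull_dim_ge[of 2 Q])
    show "is_prime_ideal (Q i)" for i using prime0 P(1) M(1) by (simp add: Q_def)
    show "Q i \<subset> Q (Suc i)" if "i < 2" for i using that PM P0 by (auto simp: Q_def less_2_cases_iff)
  qed
  then show False using dim by (simp add: one_enat_def)
qed

subsection \<open>Localizations of normal domains\<close>

text \<open>Polynomials with coefficients in K admit Euclidean division even though those over the
  whole domain need not: the leading coefficient of g has an inverse in K, which cancels the top
  term of f.\<close>

lemma subfield_polys_div:
  fixes g :: "'a::idom poly"
  assumes K: "is_subfield K" and g: "g \<in> polys_over K" "g \<noteq> 0"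
  shows "f \<in> polys_over K \<Longrightarrow>
    \<exists>q\<in>polys_over K. \<exists>r\<in>polys_over K. f = g * q + r \<and> (r = 0 \<or> degree r < degree g)"
proof (induct "degree f" arbitrary: f rule: less_induct)
  case less
  have R: "is_subring K" using K by (simp add: is_subfield_def)
  note P = subring_polys_over[OF R]
  show ?case
  proof (cases "f = 0 \<or> degree f < degree g")
    case True
    then show ?thesis
      using less.prems by (intro bexI[of _ 0] bexI[of _ f]) (auto simp: subring_0[OF P])
  next
    case False
    obtain w where w: "w \<in> K" "lead_coeff g * w = 1"
      using K g(2) polys_overD[OF g(1), of "degree g"] unfolding is_subfield_def
      by (metis leading_coeff_0_iff)
    define m where "m = monom (w * lead_coeff f) (degree f - degree g)"
    have m: "m \<in> polys_over K"
      unfolding m_def using w(1) polys_overD[OF less.prems] by (intro polys_over_monom subring_mult R)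
    define f' where "f' = f - g * m"
    have f': "f' \<in> polys_over K"
      unfolding f'_def by (intro subring_diff subring_mult P less.prems m g)
    have w0: "w * lead_coeff f \<noteq> 0" using False w(2) by auto
    have "degree m = degree f - degree g" unfolding m_def by (rule degree_monom_eq[OF w0])
    moreover have "m \<noteq> 0" using w0 by (auto simp: m_def monom_eq_0_iff)
    ultimately have "degree (g * m) = degree f"
      using False g(2) by (simp add: degree_mult_eq)
    moreover have "lead_coeff (g * m) = lead_coeff f"
    proof -
      have "lead_coeff m = w * lead_coeff f" unfolding m_def by (rule lead_coeff_monom)
      then have "lead_coeff (g * m) = lead_coeff g * (w * lead_coeff f)" by (simp only: lead_coeff_mult)
      also have "\<dots> = lead_coeff f" using w(2) by (simp only: mult.assoc[symmetric] mult_1_left)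
      finally show ?thesis .
    qed
    ultimately have "degree f' \<le> degree f" "coeff f' (degree f) = 0"
      by (auto simp: f'_def intro: degree_diff_le)
    then have lt: "f' = 0 \<or> degree f' < degree f"
      by (metis leading_coeff_0_iff le_neq_implies_less)
    have "\<exists>q\<in>polys_over K. \<exists>r\<in>polys_over K. f' = g * q + r \<and> (r = 0 \<or> degree r < degree g)"
    proof (cases "f' = 0")
      case True
      then show ?thesis by (intro bexI[of _ 0]) (auto simp: subring_0[OF P])
    next
      case False
      with lt less.hyps f' show ?thesis by blast
    qed
    then obtain q r where q: "q \<in> polys_over K" "r \<in> polys_over K" "f' = g * q + r" "r = 0 \<or> degree r < degree g"
      by blast
    have "f = g * (m + q) + r" using q(3) by (simp add: f'_def algebra_simps)
    then show ?thesis using q m subring_add[OF P] by blast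
  qed
qed

text \<open>As long as all coefficients of the relation lie in $M$, they are divisible by the generator
  of the ideal $M \<inter> K[b]$ of $K[b]$, and dividing by it lowers degrees.\<close>

lemma relation_not_in_prime:
  fixes a b :: "'a::idom"
  assumes K: "is_subfield K" and M: "is_prime_ideal M"
    and b: "\<And>p. p \<in> polys_over K \<Longrightarrow> poly p b = 0 \<Longrightarrow> p = 0"
  shows "(\<And>i. C i \<in> polys_over K) \<Longrightarrow> (\<And>i. degree (C i) \<le> N) \<Longrightarrow> \<exists>i\<le>n. C i \<noteq> 0 \<Longrightarrow>
    (\<Sum>i\<le>n. poly (C i) b * a ^ i * b ^ (n - i)) = 0 \<Longrightarrow>
    \<exists>c. (\<exists>i\<le>n. c i \<notin> M) \<and> (\<Sum>i\<le>n. c i * a ^ i * b ^ (n - i)) = 0"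
proof (induct N arbitrary: C rule: less_induct)
  case (less N)
  note I = prime_ideal_ideal[OF M]
  have R: "is_subring K" using K by (simp add: is_subfield_def)
  note P = subring_polys_over[OF R]
  show ?case
  proof (cases "\<exists>i\<le>n. poly (C i) b \<notin> M")
    case True
    then show ?thesis using less.prems(4) by (intro exI[of _ "\<lambda>i. poly (C i) b"]) auto
  next
    case False
    obtain k where k: "k \<le> n" "C k \<noteq> 0" using less.prems(3) by blast
    define G where "G p \<longleftrightarrow> p \<in> polys_over K \<and> p \<noteq> 0 \<and> poly p b \<in> M" for p
    have "G (C k)" using False k less.prems(1) by (auto simp: G_def)
    then obtain g where g: "G g" and gmin: "\<And>p. G p \<Longrightarrow> degree g \<le> degree p"
      using ex_has_least_nat[of G _ degree] by blast
    have gK: "g \<in> polys_over K" "g \<noteq> 0" "poly g b \<in> M" using g by (auto simp: G_def)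
    \<comment> \<open>A constant g would put a unit into M. Positive degree is what makes the bound
      N drop.\<close>
    have gdeg: "degree g > 0"
    proof (rule ccontr)
      assume "\<not> degree g > 0"
      then obtain w where w: "g = [:w:]" by (auto elim: degree_eq_zeroE)
      then have "w \<in> K" "w \<noteq> 0" "w \<in> M" using gK by (auto simp: polys_over_pCons)
      then have "1 \<in> M" using K ideal_mult2[OF I] unfolding is_subfield_def by metis
      then show False using prime_ideal_1[OF M] by simp
    qed
    have "\<exists>D\<in>polys_over K. C i = g * D" if i: "i \<le> n" for i
    proof -
      obtain q r where q: "q \<in> polys_over K" "r \<in> polys_over K" "C i = g * q + r" "r = 0 \<or> degree r < degree g"
        using subfield_polys_div[OF K gK(1,2) less.prems(1)] by blast
      have "poly g b * poly q b + poly r b \<in> M" using False i q(3) by auto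
      then have "poly r b \<in> M"
        using ideal_add_cancel[OF I ideal_mult2[OF I gK(3)]] by blast
      then have "r = 0" using q(2,4) gmin[of r] unfolding G_def by linarith
      then show ?thesis using q by auto
    qed
    then obtain D0 where D0: "\<And>i. i \<le> n \<Longrightarrow> D0 i \<in> polys_over K \<and> C i = g * D0 i" by metis
    \<comment> \<open>Set to 0 above n, because the induction hypothesis speaks about all
      indices.\<close>
    define D where "D i = (if i \<le> n then D0 i else 0)" for i
    have D: "D i \<in> polys_over K" for i using D0 subring_0[OF P] by (simp add: D_def)
    have CD: "C i = g * D i" if "i \<le> n" for i using D0 that by (simp add: D_def)
    have gN: "degree g \<le> N" using gmin[OF \<open>G (C k)\<close>] less.prems(2)[of k] by simp
    have "degree (D i) \<le> N - degree g" for i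
    proof (cases "i \<le> n \<and> D i \<noteq> 0")
      case True
      then have "degree (C i) = degree g + degree (D i)"
        using gK(2) by (simp add: CD degree_mult_eq)
      then show ?thesis using less.prems(2)[of i] by simp
    qed (auto simp: D_def)
    moreover have "\<exists>i\<le>n. D i \<noteq> 0" using k CD by force
    \<comment> \<open>Transcendence of b gives g(b) \<noteq> 0, so this factor cancels in the
      domain.\<close>
    moreover have "poly g b * (\<Sum>i\<le>n. poly (D i) b * a ^ i * b ^ (n - i)) = 0"
      using less.prems(4) by (simp add: sum_distrib_left CD mult.assoc)
    then have "(\<Sum>i\<le>n. poly (D i) b * a ^ i * b ^ (n - i)) = 0" using b[of g] gK by auto
    ultimately show ?thesis using less.hyps[of "N - degree g" D] D gdeg gN by simp
  qed
qed

text \<open>Seidenberg's argument: with $y = c_n x \<in> A$, the pair of leading terms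
  $c_n x^n + c_{n-1} x^{n-1}$ becomes $(y + c_{n-1}) x^{n-1}$.\<close>

lemma relation_imp_localization:
  fixes x :: "'a::idom fract"
  assumes nd: "normal_domain TYPE('a)" and M: "is_prime_ideal M"
  shows "\<exists>i\<le>n. c i \<notin> M \<Longrightarrow> (\<Sum>i\<le>n. Fract (c i) 1 * x ^ i) = 0 \<Longrightarrow>
    x \<in> localization_at M \<or> inverse x \<in> localization_at M"
proof (induct n arbitrary: c)
  case 0
  then have "c 0 = 0" by (simp add: Zero_fract_def eq_fract)
  then show ?case using 0 ideal_0[OF prime_ideal_ideal[OF M]] by simp
next
  case (Suc n)
  note I = prime_ideal_ideal[OF M]
  define A where "A = range (\<lambda>a::'a. Fract a 1)"
  have A: "is_subring A"
    unfolding is_subring_def A_def by (auto simp: Zero_fract_def One_fract_def)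
  have M0: "s \<noteq> 0" if "s \<notin> M" for s using that ideal_0[OF I] by auto
  show ?case
  proof (cases "c (Suc n) = 0")
    case True
    have "\<exists>i\<le>n. c i \<notin> M"
      using Suc.prems(1) True ideal_0[OF I] by (metis le_Suc_eq)
    then show ?thesis using Suc True by (simp flip: Zero_fract_def)
  next
    case False
    define p where "p = (\<Sum>i\<le>Suc n. monom (Fract (c i) 1) i)"
    have cp: "coeff p i = (if i \<le> Suc n then Fract (c i) 1 else 0)" for i
      by (simp add: p_def coeff_sum del: sum.atMost_Suc)
    have nz: "Fract (c (Suc n)) 1 \<noteq> 0" using False by (simp add: Zero_fract_def eq_fract)
    have "degree p \<le> Suc n" by (rule degree_le) (simp add: cp)
    moreover have "Suc n \<le> degree p" by (rule le_degree) (use nz in \<open>simp add: cp\<close>)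
    ultimately have dp: "degree p = Suc n" by simp
    have "integral_over A (lead_coeff p * x)"
    proof (rule integral_over_lead_coeff_mult[OF A])
      show "p \<in> polys_over A" using subring_0[OF A] by (auto simp: polys_over_def cp A_def)
      show "poly p x = 0" using Suc.prems(2) by (simp add: p_def poly_sum poly_monom del: sum.atMost_Suc)
    qed (simp add: dp)
    then have "Fract (c (Suc n)) 1 * x \<in> A"
      using nd unfolding normal_domain_def A_def by (simp add: dp cp)
    then obtain y where y: "Fract (c (Suc n)) 1 * x = Fract y 1" by (auto simp: A_def)
    have xy: "x = Fract y (c (Suc n))"
    proof -
      have "Fract (c (Suc n)) 1 * Fract y (c (Suc n)) = Fract y 1"
        using False by (simp add: eq_fract)
      then show ?thesis using y nz by (metis mult_left_cancel)
    qed
    show ?thesis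
    \<comment> \<open>Since x = y / c_(n+1), a denominator outside M puts x into the localization,
      and a numerator outside M does so for its inverse.\<close>
    proof (cases "c (Suc n) \<notin> M \<or> y \<notin> M")
      case True
      then show ?thesis unfolding xy localization_at_def by (auto simp: inverse_fract)
    next
      case inM: False
      define d where "d i = (if i = n then y + c n else c i)" for i
      have "(\<Sum>i\<le>n. Fract (d i) 1 * x ^ i) = (\<Sum>i<n. Fract (c i) 1 * x ^ i) + Fract (y + c n) 1 * x ^ n"
        by (simp add: d_def lessThan_Suc_atMost[symmetric])
      also have "Fract (y + c n) 1 = Fract (c (Suc n)) 1 * x + Fract (c n) 1"
        by (simp add: y)
      also have "(\<Sum>i<n. Fract (c i) 1 * x ^ i) + (Fract (c (Suc n)) 1 * x + Fract (c n) 1) * x ^ n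
          = (\<Sum>i\<le>Suc n. Fract (c i) 1 * x ^ i)"
        by (simp add: lessThan_Suc_atMost[symmetric] algebra_simps)
      finally have rel: "(\<Sum>i\<le>n. Fract (d i) 1 * x ^ i) = 0" using Suc.prems(2) by simp
      \<comment> \<open>Both y and the dropped coefficient lie in M, so the coefficient outside M
        has index at most n, and adding y does not move it into M.\<close>
      have "\<exists>i\<le>n. d i \<notin> M"
      proof -
        obtain i where i: "i \<le> Suc n" "c i \<notin> M" using Suc.prems(1) by blast
        then have "i \<le> n" using inM by (cases "i = Suc n") auto
        moreover have "d i \<notin> M" using i(2) inM ideal_add_cancel[OF I, of y] by (auto simp: d_def)
        ultimately show ?thesis by blast
      qed
      then show ?thesis using Suc.hyps rel by blast
    qed
  qed
qed

text \<open>After cancelling powers of b the equation has a nonzero constant term. This is a unit in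
  K and a multiple of b.\<close>

lemma algebraic_over_subfield_dvd_1:
  fixes b :: "'a::idom"
  assumes K: "is_subfield K" and b: "b \<noteq> 0" and p: "p \<in> polys_over K" "p \<noteq> 0" "poly p b = 0"
  shows "b dvd 1"
  using p
proof (induct p rule: pCons_induct)
  case (pCons k p)
  show ?case
  proof (cases "k = 0")
    case True
    then show ?thesis using pCons b by (auto simp: polys_over_pCons)
  next
    case False
    obtain w where w: "k * w = 1"
      using K False pCons.prems(1) by (auto simp: is_subfield_def polys_over_pCons)
    have "k + b * poly p b = 0" using pCons.prems by simp
    then have "k = b * (- poly p b)" by (simp add: eq_neg_iff_add_eq_0)
    then have "b * (- poly p b * w) = 1" using w by (simp add: mult.assoc)
    then show ?thesis by (metis dvd_triv_left)
  qed
qed simp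

text \<open>Some prime ideal avoiding 1 contains M, and maximality makes it equal to M.\<close>

lemma maximal_ideal_is_prime:
  assumes M: "is_maximal_ideal M"
  shows "is_prime_ideal M"
proof -
  have I: "is_ideal M" and "M \<noteq> UNIV" using M by (auto simp: is_maximal_ideal_def)
  then have "M \<inter> {1} = {}" using ideal_mult[OF I, of 1] by auto
  with I obtain P where P: "is_prime_ideal P" "M \<subseteq> P"
    by (rule exists_ideal_maximal_avoiding) auto
  then have "P = M" using M by (auto simp: is_maximal_ideal_def is_prime_ideal_def)
  then show ?thesis using P by simp
qed

lemma subring_localization_at:
  fixes M :: "'a::idom set"
  assumes M: "is_prime_ideal M"
  shows "is_subring (localization_at M)"
proof -
  have nz: "s \<noteq> 0" if "s \<notin> M" for s using that ideal_0[OF prime_ideal_ideal[OF M]] by auto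
  have "\<exists>c u. Fract a s + Fract b t = Fract c u \<and> u \<notin> M"
    "\<exists>c u. Fract a s * Fract b t = Fract c u \<and> u \<notin> M" if "s \<notin> M" "t \<notin> M" for a b s t
  proof -
    have "s * t \<notin> M" using that prime_ideal_mult[OF M] by blast
    then show "\<exists>c u. Fract a s + Fract b t = Fract c u \<and> u \<notin> M"
      "\<exists>c u. Fract a s * Fract b t = Fract c u \<and> u \<notin> M"
      using add_fract[OF nz[OF that(1)] nz[OF that(2)]] mult_fract[of a s b t] by blast+
  qed
  moreover have "\<exists>c u. - Fract a s = Fract c u \<and> u \<notin> M" if "s \<notin> M" for a s
    using minus_fract[of a s] that by blast
  moreover have "\<exists>c u. 0 = Fract c u \<and> u \<notin> M" "\<exists>c u. 1 = Fract c u \<and> u \<notin> M"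
    using prime_ideal_1[OF M] by (auto simp: Zero_fract_def One_fract_def)
  ultimately show ?thesis
    unfolding is_subring_def localization_at_def by blast
qed

theorem theorem2p5:
  fixes K :: "'a::idom set"
  assumes "is_subfield K"
    and "normal_domain TYPE('a)"
    and "finite_expansion K"
    and "krull_dim TYPE('a) = 1"
  shows "prufer_domain TYPE('a)"
  unfolding prufer_domain_def valuation_ring_def
proof (intro allI impI conjI ballI)
  fix M :: "'a set" and x :: "'a fract"
  assume "is_maximal_ideal M"
  then have M: "is_prime_ideal M" by (rule maximal_ideal_is_prime)
  show "is_subring (localization_at M)" by (rule subring_localization_at[OF M])
  obtain a b where ab: "x = Fract a b" "b \<noteq> 0" by (cases x) auto
  show "x \<in> localization_at M \<or> inverse x \<in> localization_at M"
  proof (cases "\<exists>p\<in>polys_over K. p \<noteq> 0 \<and> poly p b = 0")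
    case True
    then have "b dvd 1" using algebraic_over_subfield_dvd_1[OF assms(1) ab(2)] by blast
    then obtain w where "1 = b * w" by (rule dvdE)
    then have "b \<notin> M" using prime_ideal_1[OF M] prime_ideal_mult[OF M, of b w] by auto
    then show ?thesis using ab by (auto simp: localization_at_def)
  next
    case False
    then have b: "p = 0" if "p \<in> polys_over K" "poly p b = 0" for p using that by blast
    have KR: "is_subring K" using assms(1) by (simp add: is_subfield_def)
    obtain q where q: "q \<in> polys_over (ring_adjoin (insert b K))" "q \<noteq> 0" "poly q a = 0"
      using algebraically_dependent[OF assms(1,3,4) b] by blast
    have "\<exists>p\<in>polys_over K. coeff q i = poly p b" for i
      using polys_overD[OF q(1), of i] by (auto simp: ring_adjoin_single[OF KR])
    then obtain p where p: "\<And>i. p i \<in> polys_over K" "\<And>i. coeff q i = poly (p i) b" by metis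
    define n where "n = degree q"
    \<comment> \<open>The factor X^i supplies b^i, so that b^n times the equation of a takes the
      homogeneous shape in a and b. That shape is b^n times a polynomial relation for x = a/b, while
      its terms stay in A.\<close>
    define C where "C i = (if i \<le> n then p i * monom 1 i else 0)" for i
    have "C i \<in> polys_over K" for i
      using p(1) subring_polys_over[OF KR] polys_over_monom[OF KR subring_1[OF KR]]
      by (auto simp: C_def intro: subring_closed)
    moreover have "degree (C i) \<le> Max ((\<lambda>i. degree (C i)) ` {..n})" for i
      by (cases "i \<le> n") (auto simp: C_def)
    moreover have "C n \<noteq> 0" using p(2)[of n] q(2) by (auto simp: C_def n_def monom_eq_0_iff)
    moreover have "(\<Sum>i\<le>n. poly (C i) b * a ^ i * b ^ (n - i)) = b ^ n * poly q a"
      unfolding poly_altdef[of q] sum_distrib_left n_def[symmetric]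
    proof (intro sum.cong)
      fix i assume "i \<in> {..n}"
      then have "b ^ n = b ^ i * b ^ (n - i)" by (simp flip: power_add)
      with \<open>i \<in> {..n}\<close> show "poly (C i) b * a ^ i * b ^ (n - i) = b ^ n * (coeff q i * a ^ i)"
        by (simp add: C_def p(2) poly_monom algebra_simps)
    qed simp
    ultimately obtain c where c: "\<exists>i\<le>n. c i \<notin> M" "(\<Sum>i\<le>n. c i * a ^ i * b ^ (n - i)) = 0"
      using relation_not_in_prime[OF assms(1) M, of b C "Max ((\<lambda>i. degree (C i)) ` {..n})" n a] b q(3)
      by auto
    have add: "Fract (u + v) 1 = Fract u 1 + Fract v 1" for u v :: 'a by simp
    have sum: "Fract (sum f {..k}) 1 = (\<Sum>i\<le>k. Fract (f i) 1)" for f :: "nat \<Rightarrow> 'a" and k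
      by (induct k) (simp_all add: add del: add_fract)
    have pow: "Fract (u ^ k) 1 = Fract u 1 ^ k" for u :: 'a and k
    proof (induct k)
      case (Suc k)
      have "Fract (u ^ Suc k) 1 = Fract u 1 * Fract (u ^ k) 1" by simp
      then show ?case using Suc by simp
    qed (simp add: One_fract_def)
    have bx: "Fract b 1 * x = Fract a 1" using ab by (simp add: eq_fract)
    \<comment> \<open>Dehomogenization: in the fraction field the relation in a and b is b^n times
      the relation for x, and b^n can be cancelled.\<close>
    have "Fract b 1 ^ n * (\<Sum>i\<le>n. Fract (c i) 1 * x ^ i) = (\<Sum>i\<le>n. Fract (c i * a ^ i * b ^ (n - i)) 1)"
      unfolding sum_distrib_left
    proof (intro sum.cong)
      fix i assume "i \<in> {..n}"
      then have "Fract b 1 ^ n = Fract b 1 ^ i * Fract b 1 ^ (n - i)" by (simp flip: power_add)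
      then have "Fract b 1 ^ n * (Fract (c i) 1 * x ^ i)
          = Fract (c i) 1 * (Fract b 1 * x) ^ i * Fract b 1 ^ (n - i)"
        by (simp add: power_mult_distrib algebra_simps)
      also have "\<dots> = Fract (c i * a ^ i * b ^ (n - i)) 1"
        unfolding bx pow[symmetric] by simp
      finally show "Fract b 1 ^ n * (Fract (c i) 1 * x ^ i) = Fract (c i * a ^ i * b ^ (n - i)) 1" .
    qed simp
    also have "\<dots> = 0" unfolding sum[symmetric] c(2) by (simp add: Zero_fract_def)
    finally have "Fract b 1 ^ n * (\<Sum>i\<le>n. Fract (c i) 1 * x ^ i) = 0" .
    moreover have "Fract b 1 \<noteq> 0" using ab(2) by (simp add: Zero_fract_def eq_fract)
    ultimately have "(\<Sum>i\<le>n. Fract (c i) 1 * x ^ i) = 0" by simp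
    then show ?thesis using relation_imp_localization[OF assms(2) M c(1)] by blast
  qed
qed

end
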